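(* Let $X$ and $\hat X$ be real random variables on the same probability space such that $X$ has a bounded density $f_X$. Suppose that $0<\theta<1$ and let $\varphi=\varphi_\theta^{X,\hat X}$ be a tail-dominating bump function for $(X,\hat X,\theta)$ as defined in the context. If $1\le p<\infty$ and $g\in\mathcal G_{p,\varphi}$, then for all $1\le q<\infty$ we have $$\mathbb E|g(X)-g(\hat X)|^p\le 3\cdot 2^p\,(\sup f_X)^{\frac{q(1-\theta)}{q+1}}\,\big(V_{p,\varphi}(g)\big)^p\,\|X-\hat X\|_q^{\frac{q(1-\theta)}{q+1}}.$$
   Context: $\|Z\|_q=(\mathbb E|Z|^q)^{1/q}$; $a\vee b=\max(a,b)$. Bump function: $\varphi:\mathbb R\to\mathbb R$ with $0<\varphi(z)\le1$ for all $z$, $\varphi$ increasing (nondecreasing) on $(-\infty,0]$, decreasing (nonincreasing) on $(0,\infty)$, and $\lim_{|z|\to\infty}\varphi(z)=0$. Class $\mathcal G_{p,\varphi}$ ($p\in[1,\infty)$, $\varphi$ a bump function): let $\mathcal M$ be the set of signed measures $\mu$ on the Borel sets of $\mathbb R$ with $|\mu|$ $\sigma$-finite, where a signed measure is understood in the $\sigma$-finite sense $d\mu=h\,d|\mu|$ with $|\mu|$ a $\sigma$-finite positive Borel measure and $h:\mathbb R\to\{-1,1\}$ Borel. $\mathcal M_{p,\varphi}$ is the set of $\mu\in\mathcal M$ with $\int_B\varphi\,d|\mu|<\infty$ for all compact $B$ and $\int_{\mathbb R}\varphi^{1+1/p}\,d|\mu|<\infty$. For $\mu\in\mathcal M_{p,\varphi}$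 put $g^\mu(x)=\int_{(0,x]}\varphi\,d\mu$ for $x\ge0$ and $g^\mu(x)=\int_{(x,0]}\varphi\,d\mu$ for $x<0$, with $(0,0]=\emptyset$. $\Delta_{p,\varphi}$ is the set of functions $\Delta_A(x)=\sum_{i=1}^\infty\lambda_i\varphi(a_i)\chi_{\{a_i\}}(x)$ with $A=(a_i)_{i\ge1}\subset\mathbb R$ countable, $a_i\ne a_j$ for $i\ne j$, $\lambda_i\in\mathbb R$ and $\sum_i|\lambda_i|\varphi(a_i)^{1+1/p}<\infty$. Then $\mathcal G_{p,\varphi}$ is the set of all $g=c+g^\mu+\Delta_A$ with $c\in\mathbb R$, $\mu\in\mathcal M_{p,\varphi}$, $\Delta_A\in\Delta_{p,\varphi}$ (this decomposition is unique), and $$V_{p,\varphi}(g)=\int_{\mathbb R}\varphi^{1+\frac1p}\,d|\mu|+\sum_{i=1}^\infty|\lambda_i|\varphi(a_i)^{1+\frac1p}.$$ Tail-dominating bump function $\varphi_\theta^{X,\hat X}$ for $0<\theta<1$: take strictly positive monotone functions $\varphi_\theta^+:(0,\infty)\to(0,1]$ and $\varphi_\theta^-:(-\infty,0]\to(0,1]$ with $\varphi_\theta^+(K)\to0$ as $K\to\infty$, $\varphi_\theta^-(K)\to0$ as $K\to-\infty$, $[\mathbb P(X\ge K)\vee\mathbb P(\hat X\ge K)]^\theta\le\varphi_\theta^+(K)$ for $K>0$, and $[\mathbb P(X\le K)\vee\mathbb P(\hat X\le K)]^\theta\le\varphi_\theta^-(K)$ for $K\le0$; set $\varphi_\theta^{X,\hat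 X}=\varphi_\theta^+$ on $(0,\infty)$ and $\varphi_\theta^{X,\hat X}=\varphi_\theta^-$ on $(-\infty,0]$. *)

theory Defs
  imports "HOL-Probability.Probability"
begin

definition bump_function :: "(real \<Rightarrow> real) \<Rightarrow> bool" where
  "bump_function \<phi> \<longleftrightarrow>
     (\<forall>z. 0 < \<phi> z \<and> \<phi> z \<le> 1) \<and>
     mono_on {..0} \<phi> \<and> antimono_on {0<..} \<phi> \<and>
     (\<phi> \<longlongrightarrow> 0) at_infinity"

(* A signed measure d\<mu> = h d|\<mu>| is encoded as the pair (|\<mu>|, h). Because h takes values in
   {-1, 1}, the first component really is the total variation measure of \<mu>. *)
type_synonym signed_measure = "real measure \<times> (real \<Rightarrow> real)"

abbreviation tv :: "signed_measure \<Rightarrow> real measure" where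
  "tv \<mu> \<equiv> fst \<mu>"

definition signed_measures :: "signed_measure set" where
  "signed_measures =
     {(\<nu>, h). sets \<nu> = sets borel \<and> sigma_finite_measure \<nu> \<and>
              h \<in> borel_measurable borel \<and> range h \<subseteq> {-1, 1}}"

definition signed_integral :: "signed_measure \<Rightarrow> real set \<Rightarrow> (real \<Rightarrow> real) \<Rightarrow> real" where
  "signed_integral \<mu> B f = (LINT x:B|tv \<mu>. f x * snd \<mu> x)"

definition M_class :: "real \<Rightarrow> (real \<Rightarrow> real) \<Rightarrow> signed_measure set" where
  "M_class p \<phi> =
     {\<mu> \<in> signed_measures.
        (\<forall>B. compact B \<longrightarrow> (\<integral>\<^sup>+x\<in>B. ennreal (\<phi> x) \<partial>tv \<mu>) < \<infinity>) \<and>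
        (\<integral>\<^sup>+x. ennreal (\<phi> x powr (1 + 1 / p)) \<partial>tv \<mu>) < \<infinity>}"

definition g_mu :: "(real \<Rightarrow> real) \<Rightarrow> signed_measure \<Rightarrow> real \<Rightarrow> real" where
  "g_mu \<phi> \<mu> x = (if 0 \<le> x then signed_integral \<mu> {0<..x} \<phi> else signed_integral \<mu> {x<..0} \<phi>)"

(* The weights l i may be 0, so finite (and empty) sets of atoms are covered as well. *)
definition Delta_params :: "real \<Rightarrow> (real \<Rightarrow> real) \<Rightarrow> ((nat \<Rightarrow> real) \<times> (nat \<Rightarrow> real)) set" where
  "Delta_params p \<phi> = {(a, l). inj a \<and> summable (\<lambda>i. \<bar>l i\<bar> * \<phi> (a i) powr (1 + 1 / p))}"

definition Delta_fun :: "(real \<Rightarrow> real) \<Rightarrow> (nat \<Rightarrow> real) \<Rightarrow> (nat \<Rightarrow> real) \<Rightarrow> real \<Rightarrow> real" where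
  "Delta_fun \<phi> a l x = (\<Sum>i. l i * \<phi> (a i) * indicator {a i} x)"

definition decomposes ::
    "real \<Rightarrow> (real \<Rightarrow> real) \<Rightarrow> (real \<Rightarrow> real) \<Rightarrow>
     real \<Rightarrow> signed_measure \<Rightarrow> (nat \<Rightarrow> real) \<Rightarrow> (nat \<Rightarrow> real) \<Rightarrow> bool" where
  "decomposes p \<phi> g c \<mu> a l \<longleftrightarrow>
     \<mu> \<in> M_class p \<phi> \<and> (a, l) \<in> Delta_params p \<phi> \<and>
     g = (\<lambda>x. c + g_mu \<phi> \<mu> x + Delta_fun \<phi> a l x)"

definition G_class :: "real \<Rightarrow> (real \<Rightarrow> real) \<Rightarrow> (real \<Rightarrow> real) set" where
  "G_class p \<phi> = {g. \<exists>c \<mu> a l. decomposes p \<phi> g c \<mu> a l}"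

(* The common value over all decompositions of g: for a bump function \<phi> the constant, the signed
   measure and the function Delta_fun are determined by g, so this description is unique. *)
definition V_var :: "real \<Rightarrow> (real \<Rightarrow> real) \<Rightarrow> (real \<Rightarrow> real) \<Rightarrow> real" where
  "V_var p \<phi> g =
     (THE v. \<exists>c \<mu> a l. decomposes p \<phi> g c \<mu> a l \<and>
        v = (LINT x|tv \<mu>. \<phi> x powr (1 + 1 / p)) +
            (\<Sum>i. \<bar>l i\<bar> * \<phi> (a i) powr (1 + 1 / p)))"

definition tail_dominating ::
    "'w measure \<Rightarrow> ('w \<Rightarrow> real) \<Rightarrow> ('w \<Rightarrow> real) \<Rightarrow> real \<Rightarrow> (real \<Rightarrow> real) \<Rightarrow> bool" where
  "tail_dominating M X X' \<theta> \<phi> \<longleftrightarrow>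
     (\<exists>\<phi>p \<phi>m :: real \<Rightarrow> real.
        (\<forall>K>0. 0 < \<phi>p K \<and> \<phi>p K \<le> 1) \<and> (\<forall>K\<le>0. 0 < \<phi>m K \<and> \<phi>m K \<le> 1) \<and>
        (mono_on {0<..} \<phi>p \<or> antimono_on {0<..} \<phi>p) \<and>
        (mono_on {..0} \<phi>m \<or> antimono_on {..0} \<phi>m) \<and>
        (\<phi>p \<longlongrightarrow> 0) at_top \<and> (\<phi>m \<longlongrightarrow> 0) at_bot \<and>
        (\<forall>K>0. (max (measure M {\<omega> \<in> space M. K \<le> X \<omega>})
                    (measure M {\<omega> \<in> space M. K \<le> X' \<omega>})) powr \<theta> \<le> \<phi>p K) \<and>
        (\<forall>K\<le>0. (max (measure M {\<omega> \<in> space M. X \<omega> \<le> K})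
                    (measure M {\<omega> \<in> space M. X' \<omega> \<le> K})) powr \<theta> \<le> \<phi>m K) \<and>
        \<phi> = (\<lambda>K. if 0 < K then \<phi>p K else \<phi>m K))"

lemma mono_on_at_top_0:
  fixes f :: "real \<Rightarrow> real"
  assumes m: "mono_on {0<..} f" and pos: "\<forall>K>0. 0 < f K" and lim: "(f \<longlongrightarrow> 0) at_top"
  shows False
proof -
  have "\<forall>\<^sub>F K in at_top. f K < f 1"
    using order_tendstoD(2)[OF lim, of "f 1"] pos by simp
  then have "\<forall>\<^sub>F K in at_top. f K < f 1 \<and> 1 \<le> K"
    using eventually_ge_at_top[of 1] by (rule eventually_conj)
  then obtain K where "f K < f 1" "1 \<le> K"
    using eventually_happens'[OF trivial_limit_at_top_linorder] by blast
  moreover have "f 1 \<le> f K" using m \<open>1 \<le> K\<close> by (auto intro: monotone_onD)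
  ultimately show False by simp
qed

lemma antimono_on_at_bot_0:
  fixes f :: "real \<Rightarrow> real"
  assumes m: "antimono_on {..0} f" and pos: "\<forall>K\<le>0. 0 < f K" and lim: "(f \<longlongrightarrow> 0) at_bot"
  shows False
proof -
  have "\<forall>\<^sub>F K in at_bot. f K < f 0"
    using order_tendstoD(2)[OF lim, of "f 0"] pos by simp
  then have "\<forall>\<^sub>F K in at_bot. f K < f 0 \<and> K \<le> 0"
    using eventually_le_at_bot[of 0] by (rule eventually_conj)
  then obtain K where "f K < f 0" "K \<le> 0"
    using eventually_happens'[OF trivial_limit_at_bot_linorder] by blast
  moreover have "f 0 \<le> f K" using m \<open>K \<le> 0\<close> monotone_onD[OF m, of K 0] by auto
  ultimately show False by simp
qed

lemma tail_dominating_imp_bump_function: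
  assumes "tail_dominating M X X' \<theta> \<phi>"
  shows "bump_function \<phi>"
proof -
  obtain \<phi>p \<phi>m :: "real \<Rightarrow> real" where
    p: "\<forall>K>0. 0 < \<phi>p K \<and> \<phi>p K \<le> 1" and m: "\<forall>K\<le>0. 0 < \<phi>m K \<and> \<phi>m K \<le> 1" and
    mp: "mono_on {0<..} \<phi>p \<or> antimono_on {0<..} \<phi>p" and
    mm: "mono_on {..0} \<phi>m \<or> antimono_on {..0} \<phi>m" and
    lp: "(\<phi>p \<longlongrightarrow> 0) at_top" and lm: "(\<phi>m \<longlongrightarrow> 0) at_bot" and
    eq: "\<phi> = (\<lambda>K. if 0 < K then \<phi>p K else \<phi>m K)"
    using assms unfolding tail_dominating_def by blast
  have ap: "antimono_on {0<..} \<phi>p" using mp mono_on_at_top_0 p lp by blast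
  have am: "mono_on {..0} \<phi>m" using mm antimono_on_at_bot_0 m lm by blast
  have "(\<phi> \<longlongrightarrow> 0) at_top"
    by (rule Lim_transform_eventually[OF lp])
       (rule eventually_mono[OF eventually_gt_at_top[of 0]], simp add: eq)
  moreover have "(\<phi> \<longlongrightarrow> 0) at_bot"
    by (rule Lim_transform_eventually[OF lm])
       (rule eventually_mono[OF eventually_le_at_bot[of 0]], simp add: eq)
  ultimately have "(\<phi> \<longlongrightarrow> 0) at_infinity"
    by (simp add: at_infinity_eq_at_top_bot filterlim_sup)
  moreover have "mono_on {..0} \<phi>"
    using am by (auto simp: eq monotone_on_def)
  moreover have "antimono_on {0<..} \<phi>"
    using ap by (auto simp: eq monotone_on_def)
  moreover have "\<forall>z. 0 < \<phi> z \<and> \<phi> z \<le> 1"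
    using p m by (auto simp: eq not_less)
  ultimately show ?thesis by (simp add: bump_function_def)
qed

(* Only used with exponents a > 0, for which \<infinity> to the power a is \<infinity>. *)
definition ennreal_powr :: "ennreal \<Rightarrow> real \<Rightarrow> ennreal" where
  "ennreal_powr x a = (if x = \<infinity> then \<infinity> else ennreal (enn2real x powr a))"

definition Lq_norm :: "'w measure \<Rightarrow> real \<Rightarrow> ('w \<Rightarrow> real) \<Rightarrow> ennreal" where
  "Lq_norm M q Z = ennreal_powr (\<integral>\<^sup>+\<omega>. ennreal (\<bar>Z \<omega>\<bar> powr q) \<partial>M) (1 / q)"

end

theory Submission
  imports Defs
begin

text \<open>
  Both \<open>g\<^sup>\<mu>\<close> and \<open>\<Delta>\<^sub>A\<close> change between \<open>X\<close> and \<open>X'\<close> only through points \<open>a\<close> of the segment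
  spanned by \<open>X\<close> and \<open>X'\<close>. If \<open>a\<close> lies in this segment, then for every \<open>\<epsilon>\<close> either
  \<open>\<bar>X - a\<bar> \<le> \<epsilon>\<close> or \<open>\<bar>X - X'\<bar> \<ge> \<epsilon>\<close>; the bounded density, Markov's inequality and the best \<open>\<epsilon>\<close>
  bound the probability of this event by \<open>3 S\<close>, where \<open>S\<close> is the product of the powers
  \<open>q / (q + 1)\<close> of \<open>sup f\<close> and of the \<open>L\<^sup>q\<close> norm. The probability is also at most twice the tail
  probability at \<open>a\<close>, and interpolating with exponents \<open>1 - \<theta>\<close> and \<open>\<theta>\<close> gives the bound
  \<open>3 S powr (1 - \<theta>) * \<phi> a\<close>. Jensen's inequality for the weight \<open>\<phi> powr (1 + 1 / p)\<close> and Fubini's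
  theorem integrate this bound over \<open>a\<close>. Any decomposition of \<open>g\<close> computes \<open>V_var\<close>, because
  right-continuity of \<open>g\<^sup>\<mu>\<close> separates it from the countably supported \<open>\<Delta>\<^sub>A\<close>.
\<close>

section \<open>Jensen's inequality and Fubini's theorem for increments\<close>

text \<open>The graph of the convex function \<open>x powr p\<close> lies above its tangent at
  \<open>t\<close>; both sides are arranged as sums of nonnegative terms so that the inequality
  passes to \<open>ennreal\<close>. For \<open>p > 1\<close> it is \<open>p\<close> times Young's
  inequality for \<open>x\<close> and \<open>t powr (p - 1)\<close>, whose conjugate exponent
  \<open>p / (p - 1)\<close> excludes \<open>p = 1\<close>.\<close>

lemma powr_tangent_le:
  fixes x t p :: real
  assumes "0 \<le> x" "0 < t" "1 \<le> p"
  shows "p * t powr (p - 1) * x \<le> x powr p + (p - 1) * t powr p"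
proof (cases "p = 1")
  case False
  then have p: "p > 1" using assms by simp
  have "x * t powr (p - 1) \<le> x powr p / p + (t powr (p - 1)) powr (p / (p - 1)) / (p / (p - 1))"
    using p assms by (intro Youngs_inequality) (auto simp: field_simps)
  also have "(t powr (p - 1)) powr (p / (p - 1)) = t powr p"
    using p by (simp add: powr_powr)
  finally show ?thesis using p by (simp add: field_simps)
qed (use assms in auto)

text \<open>Jensen's inequality for the measure with density \<open>u\<close>, of total mass
  \<open>V\<close>. A real lower bound \<open>r\<close> stands in for the integral of
  \<open>u * F\<close>, which may be infinite.\<close>

lemma powr_nn_integral_le:
  fixes u F :: "'a \<Rightarrow> real"
  assumes [measurable]: "u \<in> borel_measurable N" "F \<in> borel_measurable N"
    and u: "\<And>t. 0 \<le> u t" and F: "\<And>t. 0 \<le> F t"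
    and V: "(\<integral>\<^sup>+t. ennreal (u t) \<partial>N) = ennreal V" and V0: "0 \<le> V"
    and p: "1 \<le> p" and r0: "0 \<le> r"
    and r: "ennreal r \<le> (\<integral>\<^sup>+t. ennreal (u t * F t) \<partial>N)"
  shows "ennreal (r powr p) \<le> ennreal (V powr (p - 1)) * (\<integral>\<^sup>+t. ennreal (u t * F t powr p) \<partial>N)"
proof (cases "r = 0")
  case True
  then show ?thesis by simp
next
  case False
  then have rp: "r > 0" using r0 by simp
  have Vp: "V > 0"
  proof (rule ccontr)
    assume "\<not> V > 0"
    then have "(\<integral>\<^sup>+t. ennreal (u t) \<partial>N) = 0" using V V0 by simp
    then have "AE t in N. u t = 0"
      using u by (subst (asm) nn_integral_0_iff_AE) (auto simp: ennreal_eq_0_iff order.antisym)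
    then have "(\<integral>\<^sup>+t. ennreal (u t * F t) \<partial>N) = 0"
      by (subst nn_integral_0_iff_AE) auto
    then show False using r rp by (simp add: ennreal_eq_0_iff)
  qed
  \<comment> \<open>Jensen's inequality through the tangent of \<open>x powr p\<close> at the mean value \<open>r / V\<close>.\<close>
  define I where "I = (\<integral>\<^sup>+t. ennreal (u t * F t powr p) \<partial>N)"
  define t0 where "t0 = r / V"
  have t0: "t0 > 0" using rp Vp by (simp add: t0_def)
  have "ennreal (p * t0 powr (p - 1) * r) \<le> ennreal (p * t0 powr (p - 1)) * (\<integral>\<^sup>+t. ennreal (u t * F t) \<partial>N)"
    using mult_left_mono[OF r zero_le] p r0 by (subst ennreal_mult) auto
  also have "\<dots> = (\<integral>\<^sup>+t. ennreal (p * t0 powr (p - 1) * F t * u t) \<partial>N)"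
    using p u F by (subst nn_integral_cmult[symmetric]) (auto simp: ennreal_mult[symmetric] mult_ac)
  also have "\<dots> \<le> (\<integral>\<^sup>+t. ennreal (u t * F t powr p) + ennreal ((p - 1) * t0 powr p) * ennreal (u t) \<partial>N)"
  proof (rule nn_integral_mono)
    fix t
    have "p * t0 powr (p - 1) * F t * u t \<le> (F t powr p + (p - 1) * t0 powr p) * u t"
      using powr_tangent_le[OF F t0 p] u by (intro mult_right_mono) auto
    also have "\<dots> = u t * F t powr p + (p - 1) * t0 powr p * u t" by (simp add: algebra_simps)
    finally show "ennreal (p * t0 powr (p - 1) * F t * u t)
        \<le> ennreal (u t * F t powr p) + ennreal ((p - 1) * t0 powr p) * ennreal (u t)"
      using p u by (simp add: ennreal_mult[symmetric] ennreal_plus[symmetric] del: ennreal_plus)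
  qed
  also have "\<dots> = I + ennreal ((p - 1) * t0 powr p) * ennreal V"
    by (simp add: nn_integral_add nn_integral_cmult V I_def)
  finally have main: "ennreal (p * t0 powr (p - 1) * r) \<le> I + ennreal ((p - 1) * t0 powr p * V)"
    using p V0 by (simp add: ennreal_mult)
  show ?thesis
  proof (cases I)
    case top
    then show ?thesis using Vp by (simp add: I_def[symmetric] ennreal_mult_top)
  next
    case (real i)
    then have "p * t0 powr (p - 1) * r \<le> i + (p - 1) * t0 powr p * V"
      using main p V0 by (simp add: ennreal_plus[symmetric] del: ennreal_plus)
    \<comment> \<open>With \<open>t0 = r / V\<close> the tangent inequality reads
      \<open>p * c \<le> i + (p - 1) * c\<close>, where \<open>c\<close> is the common value of
      these two sides.\<close>
    moreover have "t0 powr (p - 1) * r = V * t0 powr p"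
      using t0 Vp by (simp add: t0_def powr_diff field_simps)
    ultimately have "t0 powr p * V \<le> i" by (simp add: algebra_simps)
    then have "V powr (p - 1) * (t0 powr p * V) \<le> V powr (p - 1) * i" by (intro mult_left_mono) auto
    moreover have "V powr (p - 1) * (t0 powr p * V) = r powr p"
      using rp Vp by (simp add: t0_def powr_divide powr_diff)
    ultimately show ?thesis using real
      by (simp add: I_def[symmetric] ennreal_mult[symmetric])
  qed
qed

lemma in_closed_segment_real_iff: "a \<in> closed_segment x y \<longleftrightarrow> min x y \<le> a \<and> a \<le> max x y" for a x y :: real
  by (auto simp: closed_segment_eq_real_ivl)

text \<open>The point and both end points may vary, which gives the joint measurability on the
  product space that Fubini's theorem needs.\<close>

lemma measurable_indicator_closed_segment [measurable (raw)]:
  fixes f g h :: "_ \<Rightarrow> real"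
  assumes [measurable]: "f \<in> borel_measurable M" "g \<in> borel_measurable M" "h \<in> borel_measurable M"
  shows "(\<lambda>x. indicator (closed_segment (f x) (g x)) (h x) :: real) \<in> borel_measurable M"
  unfolding in_closed_segment_real_iff indicator_def by simp

text \<open>A common frame for both parts of \<open>g\<close>: the points \<open>b t\<close> carry
  weights \<open>w t\<close>, and \<open>N\<close> is later \<open>\<nu>\<close> or the counting
  measure on the indices of the atoms. After Jensen and Fubini the factor
  \<open>\<phi> (b t)\<close> of the probability bound cancels a denominator, and
  \<open>V powr (p - 1)\<close> and \<open>V\<close> multiply to \<open>V powr p\<close>.\<close>

lemma nn_integral_powr_increment_le:
  fixes w b :: "'a \<Rightarrow> real" and \<phi> :: "real \<Rightarrow> real"
  assumes N: "sigma_finite_measure N" and M: "prob_space M"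
    and [measurable]: "w \<in> borel_measurable N" "b \<in> borel_measurable N" "\<phi> \<in> borel_measurable borel"
      "X \<in> borel_measurable M" "X' \<in> borel_measurable M"
    and w: "\<And>t. 0 \<le> w t" and \<phi>: "\<And>x. 0 < \<phi> x"
    and V: "(\<integral>\<^sup>+t. ennreal (w t * \<phi> (b t) powr (1 / p)) \<partial>N) = ennreal V" and V0: "0 \<le> V"
    and p: "1 \<le> p" and C: "0 \<le> C"
    and P: "\<And>a. (\<integral>\<^sup>+\<omega>. ennreal (indicator (closed_segment (X \<omega>) (X' \<omega>)) a) \<partial>M) \<le> ennreal (C * \<phi> a)"
    and r0: "\<And>\<omega>. 0 \<le> r \<omega>"
    and r: "\<And>\<omega>. ennreal (r \<omega>) \<le> (\<integral>\<^sup>+t. ennreal (w t * indicator (closed_segment (X \<omega>) (X' \<omega>)) (b t)) \<partial>N)"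
  shows "(\<integral>\<^sup>+\<omega>. ennreal (r \<omega> powr p) \<partial>M) \<le> ennreal (C * V powr p)"
proof -
  interpret N: sigma_finite_measure N by fact
  interpret M: prob_space M by fact
  interpret pair_sigma_finite N M ..
  let ?i = "\<lambda>\<omega> t. indicator (closed_segment (X \<omega>) (X' \<omega>)) (b t) :: real"
  let ?u = "\<lambda>t. w t * \<phi> (b t) powr (1 / p)"
  have "ennreal (r \<omega> powr p) \<le> ennreal (V powr (p - 1)) *
      (\<integral>\<^sup>+t. ennreal (?u t / \<phi> (b t) * ?i \<omega> t) \<partial>N)" for \<omega>
  proof -
    \<comment> \<open>The exponent \<open>- (1 / p)\<close> makes \<open>?u t * ?F t\<close> the
      given integrand, while the \<open>p\<close>-th power of \<open>?F t\<close> contributes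
      exactly the factor \<open>1 / \<phi> (b t)\<close> that the probability bound cancels.\<close>
    let ?F = "\<lambda>t. \<phi> (b t) powr (- (1 / p)) * ?i \<omega> t"
    have 1: "?u t * ?F t = w t * ?i \<omega> t" for t
      using \<phi>[of "b t"] by (simp add: powr_minus field_simps)
    have 2: "?u t * ?F t powr p = ?u t / \<phi> (b t) * ?i \<omega> t" for t
    proof -
      have "?F t powr p = \<phi> (b t) powr (- 1) * ?i \<omega> t"
        using p by (auto simp: indicator_def powr_powr)
      then show ?thesis using \<phi>[of "b t"] by (simp add: powr_minus divide_inverse)
    qed
    have "ennreal (r \<omega> powr p) \<le> ennreal (V powr (p - 1)) *
        (\<integral>\<^sup>+t. ennreal (?u t * ?F t powr p) \<partial>N)"
      by (rule powr_nn_integral_le) (use w V V0 p r0 r in \<open>auto simp: 1\<close>)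
    then show ?thesis by (simp only: 2)
  qed
  then have "(\<integral>\<^sup>+\<omega>. ennreal (r \<omega> powr p) \<partial>M) \<le> (\<integral>\<^sup>+\<omega>. ennreal (V powr (p - 1)) *
      (\<integral>\<^sup>+t. ennreal (?u t / \<phi> (b t) * ?i \<omega> t) \<partial>N) \<partial>M)"
    by (rule nn_integral_mono)
  also have "\<dots> = ennreal (V powr (p - 1)) * (\<integral>\<^sup>+\<omega>. (\<integral>\<^sup>+t. ennreal (?u t / \<phi> (b t) * ?i \<omega> t) \<partial>N) \<partial>M)"
    by (rule nn_integral_cmult) measurable
  also have "(\<integral>\<^sup>+\<omega>. (\<integral>\<^sup>+t. ennreal (?u t / \<phi> (b t) * ?i \<omega> t) \<partial>N) \<partial>M)
      = (\<integral>\<^sup>+t. (\<integral>\<^sup>+\<omega>. ennreal (?u t / \<phi> (b t) * ?i \<omega> t) \<partial>M) \<partial>N)"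
    by (rule Fubini') measurable
  also have "\<dots> \<le> (\<integral>\<^sup>+t. ennreal C * ennreal (?u t) \<partial>N)"
  proof (rule nn_integral_mono)
    fix t
    have nn: "0 \<le> ?u t / \<phi> (b t)" using w \<phi>[of "b t"] by simp
    have "(\<integral>\<^sup>+\<omega>. ennreal (?u t / \<phi> (b t) * ?i \<omega> t) \<partial>M)
        = ennreal (?u t / \<phi> (b t)) * (\<integral>\<^sup>+\<omega>. ennreal (?i \<omega> t) \<partial>M)"
      using nn by (subst nn_integral_cmult[symmetric]) (auto simp: ennreal_mult[symmetric])
    also have "\<dots> \<le> ennreal (?u t / \<phi> (b t)) * ennreal (C * \<phi> (b t))"
      by (intro mult_left_mono P) auto
    also have "\<dots> = ennreal C * ennreal (?u t)"
      using nn C w \<phi>[of "b t"] by (simp add: ennreal_mult[symmetric] field_simps)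
    finally show "(\<integral>\<^sup>+\<omega>. ennreal (?u t / \<phi> (b t) * ?i \<omega> t) \<partial>M) \<le> ennreal C * ennreal (?u t)" .
  qed
  also have "\<dots> = ennreal C * ennreal V" by (simp add: nn_integral_cmult V)
  also have "ennreal (V powr (p - 1)) * (ennreal C * ennreal V) = ennreal (C * V powr p)"
    using C V0 by (cases "V = 0") (auto simp: ennreal_mult[symmetric] powr_diff)
  finally show ?thesis by (simp add: mult_left_mono)
qed

section \<open>Probability that a fixed point lies between \<open>X\<close> and
  \<open>X'\<close>\<close>

text \<open>A bound \<open>s \<le> 0\<close> would give the law of \<open>X\<close> total mass 0
  instead of 1. Positivity of \<open>s\<close> permits the divisions by \<open>s\<close> in the
  choice of the radius.\<close>

lemma distributed_bound_pos:
  fixes f :: "real \<Rightarrow> real"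
  assumes "prob_space M" and X: "distributed M lborel X (\<lambda>x. ennreal (f x))" and f: "\<And>x. f x \<le> s"
  shows "0 < s"
proof (rule ccontr)
  interpret prob_space M by fact
  assume "\<not> 0 < s"
  then have "(\<lambda>x. ennreal (f x)) = (\<lambda>x. 0)"
    using f by (auto simp: ennreal_eq_0_iff fun_eq_iff intro: order.trans[OF f])
  with distributed_emeasure[OF X, of UNIV] show False
    by (simp add: emeasure_space_1)
qed

lemma distributed_near_point_le:
  assumes "prob_space M" and X: "distributed M lborel X (\<lambda>x. ennreal (f x))"
    and f: "\<And>x. f x \<le> s" and e: "0 \<le> e"
  shows "measure M {\<omega> \<in> space M. \<bar>X \<omega> - a\<bar> \<le> e} \<le> 2 * e * s"
proof -
  interpret prob_space M by fact
  have s: "0 < s" using distributed_bound_pos[OF assms(1) X f] .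
  have "{\<omega> \<in> space M. \<bar>X \<omega> - a\<bar> \<le> e} = X -` {a - e..a + e} \<inter> space M" by auto
  then have "emeasure M {\<omega> \<in> space M. \<bar>X \<omega> - a\<bar> \<le> e}
      = (\<integral>\<^sup>+x. ennreal (f x) * indicator {a - e..a + e} x \<partial>lborel)"
    using distributed_emeasure[OF X, of "{a - e..a + e}"] by simp
  also have "\<dots> \<le> (\<integral>\<^sup>+x. ennreal s * indicator {a - e..a + e} x \<partial>lborel)"
    by (intro nn_integral_mono mult_right_mono ennreal_leI f) auto
  also have "\<dots> = ennreal (2 * e * s)"
    using e s by (simp add: nn_integral_cmult ennreal_mult[symmetric] mult.commute)
  finally show ?thesis using e s by (simp add: emeasure_eq_measure)
qed

lemma Markov_powr:
  assumes "prob_space M" and [measurable]: "Z \<in> borel_measurable M"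
    and m: "(\<integral>\<^sup>+\<omega>. ennreal (\<bar>Z \<omega>\<bar> powr q) \<partial>M) = ennreal m" "0 \<le> m"
    and e: "0 < e" and q: "0 < q"
  shows "measure M {\<omega> \<in> space M. e \<le> \<bar>Z \<omega>\<bar>} \<le> e powr (- q) * m"
proof -
  interpret prob_space M by fact
  have "emeasure M {\<omega> \<in> space M. e \<le> \<bar>Z \<omega>\<bar>} = (\<integral>\<^sup>+\<omega>. indicator {\<omega> \<in> space M. e \<le> \<bar>Z \<omega>\<bar>} \<omega> \<partial>M)"
    by simp
  also have "\<dots> \<le> (\<integral>\<^sup>+\<omega>. ennreal (e powr (- q)) * ennreal (\<bar>Z \<omega>\<bar> powr q) \<partial>M)"
  proof (rule nn_integral_mono)
    fix \<omega>
    have "1 \<le> e powr (- q) * \<bar>Z \<omega>\<bar> powr q" if "e \<le> \<bar>Z \<omega>\<bar>"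
    proof -
      have "e powr (- q) * e powr q \<le> e powr (- q) * \<bar>Z \<omega>\<bar> powr q"
        using that e q by (intro mult_left_mono powr_mono2) auto
      then show ?thesis using e by (simp add: powr_minus)
    qed
    then show "indicator {\<omega> \<in> space M. e \<le> \<bar>Z \<omega>\<bar>} \<omega> \<le> ennreal (e powr (- q)) * ennreal (\<bar>Z \<omega>\<bar> powr q)"
      by (auto simp: indicator_def ennreal_mult[symmetric])
  qed
  also have "\<dots> = ennreal (e powr (- q) * m)"
    using m by (simp add: nn_integral_cmult ennreal_mult)
  finally show ?thesis using m by (simp add: emeasure_eq_measure)
qed

text \<open>Here \<open>m\<close> is the \<open>q\<close>-th absolute moment, so
  \<open>m powr (1 / (q + 1))\<close> is the norm of order \<open>q\<close> raised to the power
  \<open>q / (q + 1)\<close>.\<close>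

lemma prob_closed_segment_le:
  assumes "prob_space M"
    and [measurable]: "X \<in> borel_measurable M" "X' \<in> borel_measurable M"
    and X: "distributed M lborel X (\<lambda>x. ennreal (f x))"
    and f: "\<And>x. f x \<le> s"
    and m: "(\<integral>\<^sup>+\<omega>. ennreal (\<bar>X \<omega> - X' \<omega>\<bar> powr q) \<partial>M) = ennreal m" "0 \<le> m"
    and q: "0 < q"
  shows "measure M {\<omega> \<in> space M. a \<in> closed_segment (X \<omega>) (X' \<omega>)}
    \<le> 3 * (s powr (q / (q + 1)) * m powr (1 / (q + 1)))"
proof -
  interpret prob_space M by fact
  have s: "0 < s" using distributed_bound_pos[OF assms(1) X f] .
  let ?P = "prob {\<omega> \<in> space M. a \<in> closed_segment (X \<omega>) (X' \<omega>)}"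
  have eps: "?P \<le> 2 * e * s + e powr (- q) * m" if "0 < e" for e
  proof -
    have "?P \<le> prob ({\<omega> \<in> space M. \<bar>X \<omega> - a\<bar> \<le> e} \<union> {\<omega> \<in> space M. e \<le> \<bar>X \<omega> - X' \<omega>\<bar>})"
      by (intro finite_measure_mono) (auto simp: closed_segment_eq_real_ivl)
    also have "\<dots> \<le> prob {\<omega> \<in> space M. \<bar>X \<omega> - a\<bar> \<le> e} + prob {\<omega> \<in> space M. e \<le> \<bar>X \<omega> - X' \<omega>\<bar>}"
      by (intro measure_Un_le) auto
    also have "\<dots> \<le> 2 * e * s + e powr (- q) * m"
      using that by (intro add_mono distributed_near_point_le[OF assms(1) X f]
          Markov_powr[OF assms(1) _ m _ q]) auto
    finally show ?thesis .
  qed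
  show ?thesis
  proof (cases "m = 0")
    case True
    \<comment> \<open>For \<open>m = 0\<close> smaller radii are always better; the radius
      \<open>e / (2 * s)\<close> bounds the probability by an arbitrary
      \<open>e > 0\<close>.\<close>
    have "?P \<le> 0 + e" if "0 < e" for e
      using eps[of "e / (2 * s)"] that s True by simp
    then have "?P \<le> 0" by (rule field_le_epsilon)
    then show ?thesis using True by simp
  next
    case False
    then have mp: "0 < m" using m by simp
    \<comment> \<open>The radius with \<open>e powr (q + 1) = m / s\<close> equalises
      \<open>e * s\<close> and \<open>e powr (- q) * m\<close>, and the coefficients 2 and 1 add up
      to 3.\<close>
    define e where "e = (m / s) powr (1 / (q + 1))"
    have e: "e > 0" using mp s by (simp add: e_def)
    have q1: "1 - 1 / (q + 1) = q / (q + 1)" using q by (simp add: field_simps)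
    have "e * s = m powr (1 / (q + 1)) * (s powr 1 / s powr (1 / (q + 1)))"
      using mp s by (simp add: e_def powr_divide)
    also have "\<dots> = s powr (q / (q + 1)) * m powr (1 / (q + 1))"
      by (simp only: powr_diff[symmetric] q1 mult.commute)
    finally have 1: "e * s = s powr (q / (q + 1)) * m powr (1 / (q + 1))" .
    have "e powr (- q) * m = e * (e powr (- (q + 1)) * m)"
      using e by (simp add: powr_diff powr_minus field_simps powr_add)
    also have "e powr (- (q + 1)) = (m / s) powr (- 1)"
    proof -
      have "1 / (q + 1) * - (q + 1) = - 1" using q by (simp add: field_simps)
      then show ?thesis unfolding e_def powr_powr by (simp only:)
    qed
    also have "\<dots> = s / m" using mp s by (simp add: powr_minus)
    finally have 2: "e powr (- q) * m = e * s" using mp by simp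
    show ?thesis using eps[OF e] 1 2 by simp
  qed
qed

text \<open>If \<open>a > 0\<close> lies between \<open>X\<close> and \<open>X'\<close>, one of them
  is at least \<open>a\<close>; if \<open>a \<le> 0\<close>, one of them is at most
  \<open>a\<close>. The witness \<open>T\<close>, the larger of the two tail probabilities, hides
  which tail is meant, so later arguments need not distinguish the sign of \<open>a\<close>.\<close>

lemma tail_dominating_closed_segment:
  assumes "prob_space M"
    and [measurable]: "X \<in> borel_measurable M" "X' \<in> borel_measurable M"
    and t: "tail_dominating M X X' \<theta> \<phi>" and \<theta>: "0 < \<theta>"
  obtains T where "0 \<le> T" "T \<le> 1" "T powr \<theta> \<le> \<phi> a"
    "measure M {\<omega> \<in> space M. a \<in> closed_segment (X \<omega>) (X' \<omega>)} \<le> 2 * T"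
proof -
  interpret prob_space M by fact
  let ?P = "prob {\<omega> \<in> space M. a \<in> closed_segment (X \<omega>) (X' \<omega>)}"
  show ?thesis
  proof (cases "0 < a")
    case True
    let ?A = "{\<omega> \<in> space M. a \<le> X \<omega>}" and ?B = "{\<omega> \<in> space M. a \<le> X' \<omega>}"
    have "?P \<le> prob (?A \<union> ?B)"
      by (intro finite_measure_mono) (auto simp: closed_segment_eq_real_ivl)
    also have "\<dots> \<le> prob ?A + prob ?B" by (intro measure_Un_le) auto
    finally have "?P \<le> 2 * max (prob ?A) (prob ?B)" by linarith
    then show ?thesis using t True
      by (intro that[of "max (prob ?A) (prob ?B)"]) (auto simp: tail_dominating_def le_max_iff_disj)
  next
    case False
    let ?A = "{\<omega> \<in> space M. X \<omega> \<le> a}" and ?B = "{\<omega> \<in> space M. X' \<omega> \<le> a}"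
    have "?P \<le> prob (?A \<union> ?B)"
      by (intro finite_measure_mono) (auto simp: closed_segment_eq_real_ivl)
    also have "\<dots> \<le> prob ?A + prob ?B" by (intro measure_Un_le) auto
    finally have "?P \<le> 2 * max (prob ?A) (prob ?B)" by linarith
    then show ?thesis using t False
      by (intro that[of "max (prob ?A) (prob ?B)"]) (auto simp: tail_dominating_def le_max_iff_disj)
  qed
qed

text \<open>In \<open>P = P powr \<theta> * P powr (1 - \<theta>)\<close> the tail bound controls
  the first factor and the density bound the second.\<close>

lemma interpolate_le:
  fixes P T S \<theta> y :: real
  assumes "0 \<le> P" "P \<le> 2 * T" "P \<le> 3 * S" "0 \<le> T" "0 \<le> S" "T powr \<theta> \<le> y" "0 < \<theta>" "\<theta> < 1"
  shows "P \<le> 3 * S powr (1 - \<theta>) * y"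
proof -
  have "P = P powr \<theta> * P powr (1 - \<theta>)" using assms by (cases "P = 0") (auto simp: powr_add[symmetric])
  also have "\<dots> \<le> (2 * T) powr \<theta> * (3 * S) powr (1 - \<theta>)"
    using assms by (intro mult_mono powr_mono2) auto
  also have "\<dots> = (2 powr \<theta> * 3 powr (1 - \<theta>)) * (T powr \<theta> * S powr (1 - \<theta>))"
    using assms by (simp add: powr_mult)
  \<comment> \<open>Enlarging \<open>2 powr \<theta>\<close> to \<open>3 powr \<theta>\<close> makes
    the constant exactly 3 for every \<open>\<theta>\<close>.\<close>
  also have "\<dots> \<le> (3 powr \<theta> * 3 powr (1 - \<theta>)) * (y * S powr (1 - \<theta>))"
    using assms order.trans[OF powr_ge_zero \<open>T powr \<theta> \<le> y\<close>]
    by (intro mult_mono powr_mono2) auto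
  also have "3 powr \<theta> * 3 powr (1 - \<theta>) = (3 :: real)" by (simp add: powr_add[symmetric])
  finally show ?thesis by (simp add: mult_ac)
qed

section \<open>Bump functions and the intervals anchored at 0\<close>

lemma bump_function_measurable:
  assumes "bump_function \<phi>"
  shows "\<phi> \<in> borel_measurable borel"
proof -
  have 1: "\<phi> \<in> borel_measurable (restrict_space borel {..0})"
    using assms by (intro borel_measurable_mono_on_fnc) (simp add: bump_function_def)
  have "mono_on {0<..} (\<lambda>x. - \<phi> x)"
    using assms by (simp add: bump_function_def monotone_on_def)
  then have "(\<lambda>x. - (- \<phi> x)) \<in> borel_measurable (restrict_space borel {0<..})"
    by (intro borel_measurable_uminus borel_measurable_mono_on_fnc)
  then have 2: "\<phi> \<in> borel_measurable (restrict_space borel {0<..})" by simp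
  show ?thesis
  proof (rule measurable_piecewise_restrict)
    show "countable {{..0}, {0::real<..}}" by simp
  qed (use 1 2 in auto)
qed

lemma bump_function_pos: "bump_function \<phi> \<Longrightarrow> 0 < \<phi> x"
  by (simp add: bump_function_def)

text \<open>The set over which \<^const>\<open>g_mu\<close> integrates at \<open>x\<close>: one of the two parts is always empty.\<close>

definition anchored_interval :: "real \<Rightarrow> real set" where
  "anchored_interval x = {0<..x} \<union> {x<..0}"

lemma anchored_interval_bounded: "anchored_interval x \<subseteq> {- \<bar>x\<bar>..\<bar>x\<bar>}"
  by (auto simp: anchored_interval_def)

lemma anchored_interval_borel [measurable]: "anchored_interval x \<in> sets borel"
  by (simp add: anchored_interval_def)

lemma anchored_interval_0 [simp]: "anchored_interval 0 = {}"
  by (simp add: anchored_interval_def)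

text \<open>Intervals on the same side of 0 are nested; those on opposite sides are disjoint, and
  the empty set is the interval anchored at \<open>0\<close>.\<close>

lemma Int_stable_anchored_interval: "Int_stable (range anchored_interval)"
proof (rule Int_stableI_image)
  fix x y :: real
  have "anchored_interval x \<inter> anchored_interval y =
      anchored_interval (if 0 \<le> x \<and> 0 \<le> y then min x y else if x < 0 \<and> y < 0 then max x y else 0)"
    by (auto simp: anchored_interval_def min_def max_def)
  then show "\<exists>z\<in>UNIV. anchored_interval x \<inter> anchored_interval y = anchored_interval z" by blast
qed

lemma UN_anchored_interval: "(\<Union>n::int. anchored_interval (of_int n)) = UNIV"
proof -
  \<comment> \<open>The first interval catches \<open>x > 0\<close>. For \<open>x \<le> 0\<close>
    the interval is open on the left, so its end must be an integer strictly below \<open>x\<close>,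
    such as \<open>\<lceil>x\<rceil> - 1\<close>.\<close>
  have "x \<in> anchored_interval (of_int \<lceil>x\<rceil>) \<union> anchored_interval (of_int (\<lceil>x\<rceil> - 1))" for x
    by (simp add: anchored_interval_def) linarith
  then show ?thesis by blast
qed

lemma borel_eq_sigma_anchored_interval: "sets borel = sigma_sets UNIV (range anchored_interval)"
proof
  have "range (\<lambda>a::real. {..a}) \<subseteq> sigma_sets UNIV (range anchored_interval)"
  proof clarify
    fix a :: real
    interpret sigma_algebra UNIV "sigma_sets UNIV (range anchored_interval)"
      by (rule sigma_algebra_sigma_sets) auto
    have J: "anchored_interval x \<in> sigma_sets UNIV (range anchored_interval)" for x
      by (rule sigma_sets.Basic) auto
    \<comment> \<open>This union is \<open>{..0}\<close>; every \<open>{..a}\<close> arises from it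
      by adding or removing one anchored interval.\<close>
    have U: "(\<Union>n::nat. anchored_interval (- real n)) \<in> sigma_sets UNIV (range anchored_interval)"
      by (rule sigma_sets.Union) (rule J)
    have 1: "{..a} = (\<Union>n::nat. anchored_interval (- real n)) \<union> anchored_interval a" if "0 \<le> a"
    proof -
      have "\<exists>n. - real n < x" for x using reals_Archimedean2[of "- x"] by (auto simp: minus_less_iff)
      then show ?thesis using that by (auto simp: anchored_interval_def)
    qed
    have 2: "{..a} = (\<Union>n::nat. anchored_interval (- real n)) - anchored_interval a" if "a < 0"
    proof -
      have "\<exists>n. - real n < x" for x using reals_Archimedean2[of "- x"] by (auto simp: minus_less_iff)
      then show ?thesis using that by (auto simp: anchored_interval_def)
    qed
    show "{..a} \<in> sigma_sets UNIV (range anchored_interval)"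
    proof (cases "0 \<le> a")
      case True
      show ?thesis unfolding 1[OF True] by (rule Un[OF U J])
    next
      case False
      then have "a < 0" by simp
      show ?thesis unfolding 2[OF \<open>a < 0\<close>] by (rule Diff[OF U J])
    qed
  qed
  then have "sigma_sets UNIV (range (\<lambda>a::real. {..a})) \<subseteq> sigma_sets UNIV (range anchored_interval)"
    by (rule sigma_sets_mono)
  then show "sets borel \<subseteq> sigma_sets UNIV (range anchored_interval)"
    by (simp add: borel_eq_atMost)
  show "sigma_sets UNIV (range anchored_interval) \<subseteq> sets borel"
  proof -
    have "range anchored_interval \<subseteq> sets borel" by auto
    from sets.sigma_sets_subset[OF this] show ?thesis by simp
  qed
qed

text \<open>Dynkin's argument for signed integrals. All sets are cut down to one anchored interval
  because integrability is given only there, and the complement step subtracts from the integral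
  over the whole interval.\<close>

lemma set_integral_eq_of_anchored_interval:
  fixes f1 f2 :: "real \<Rightarrow> real"
  assumes s [measurable_cong]: "sets \<nu>1 = sets borel" "sets \<nu>2 = sets borel"
    and I1: "\<And>x. set_integrable \<nu>1 (anchored_interval x) f1"
    and I2: "\<And>x. set_integrable \<nu>2 (anchored_interval x) f2"
    and eq: "\<And>x. (LINT t:anchored_interval x|\<nu>1. f1 t) = (LINT t:anchored_interval x|\<nu>2. f2 t)"
    and B: "B \<in> sets borel"
  shows "(LINT t:B \<inter> anchored_interval x|\<nu>1. f1 t) = (LINT t:B \<inter> anchored_interval x|\<nu>2. f2 t)"
proof -
  let ?J = "anchored_interval x"
  have S1: "set_integrable \<nu>1 (A \<inter> ?J) f1" if "A \<in> sets borel" for A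
    by (rule set_integrable_subset[OF I1[of x]]) (use that s in auto)
  have S2: "set_integrable \<nu>2 (A \<inter> ?J) f2" if "A \<in> sets borel" for A
    by (rule set_integrable_subset[OF I2[of x]]) (use that s in auto)
  note Int_stable_anchored_interval
  moreover have "range anchored_interval \<subseteq> Pow UNIV" by simp
  moreover have "B \<in> sigma_sets UNIV (range anchored_interval)"
    using B by (simp add: borel_eq_sigma_anchored_interval)
  ultimately show ?thesis
  proof (induction rule: sigma_sets_induct_disjoint)
    case (basic A)
    then obtain z where "A \<inter> ?J = anchored_interval z"
      using Int_stable_anchored_interval unfolding Int_stable_def by blast
    then show ?case using eq by simp
  next
    case empty
    then show ?case by (simp add: set_lebesgue_integral_def)
  next
    case (compl A)
    then have A: "A \<in> sets borel" by (simp add: borel_eq_sigma_anchored_interval)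
    have J: "?J = (A \<inter> ?J) \<union> ((UNIV - A) \<inter> ?J)" by auto
    have 1: "(LINT t:?J|\<nu>1. f1 t) = (LINT t:A \<inter> ?J|\<nu>1. f1 t) + (LINT t:(UNIV - A) \<inter> ?J|\<nu>1. f1 t)"
      by (subst J, rule set_integral_Un) (use A in \<open>auto intro!: S1\<close>)
    have 2: "(LINT t:?J|\<nu>2. f2 t) = (LINT t:A \<inter> ?J|\<nu>2. f2 t) + (LINT t:(UNIV - A) \<inter> ?J|\<nu>2. f2 t)"
      by (subst J, rule set_integral_Un) (use A in \<open>auto intro!: S2\<close>)
    show ?case using 1 2 eq[of x] compl by simp
  next
    case (union F)
    then have F: "F i \<in> sets borel" for i by (auto simp: borel_eq_sigma_anchored_interval)
    have d: "(F i \<inter> ?J) \<inter> (F j \<inter> ?J) = {}" if "i \<noteq> j" for i j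
      using union(1) that by (auto simp: disjoint_family_on_def)
    have U: "(\<Union>i. F i) \<inter> ?J = (\<Union>i. F i \<inter> ?J)" by auto
    have "(LINT t:(\<Union>i. F i) \<inter> ?J|\<nu>1. f1 t) = (\<Sum>i. LINT t:F i \<inter> ?J|\<nu>1. f1 t)"
      unfolding U
    proof (rule lebesgue_integral_countable_add)
      show "set_integrable \<nu>1 (\<Union>i. F i \<inter> ?J) f1"
        unfolding U[symmetric] by (rule S1) (use F in auto)
    qed (use F d s in auto)
    moreover have "(LINT t:(\<Union>i. F i) \<inter> ?J|\<nu>2. f2 t) = (\<Sum>i. LINT t:F i \<inter> ?J|\<nu>2. f2 t)"
      unfolding U
    proof (rule lebesgue_integral_countable_add)
      show "set_integrable \<nu>2 (\<Union>i. F i \<inter> ?J) f2"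
        unfolding U[symmetric] by (rule S2) (use F in auto)
    qed (use F d s in auto)
    ultimately show ?case using union(3) by simp
  qed
qed

section \<open>The function \<open>g_mu\<close>: integrability, increments, right-continuity\<close>

lemma M_classD:
  assumes "(\<nu>, h) \<in> M_class p \<phi>"
  shows "sets \<nu> = sets borel" "sigma_finite_measure \<nu>" "h \<in> borel_measurable borel"
    "\<And>x. h x = 1 \<or> h x = -1"
    "compact B \<Longrightarrow> (\<integral>\<^sup>+x\<in>B. ennreal (\<phi> x) \<partial>\<nu>) < \<infinity>"
    "(\<integral>\<^sup>+x. ennreal (\<phi> x powr (1 + 1 / p)) \<partial>\<nu>) < \<infinity>"
  using assms by (auto simp: M_class_def signed_measures_def)

text \<open>The factor \<open>k\<close> is later the sign \<open>h\<close> or the constant 1, for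
  the signed integral and the variation. \<open>M_class\<close> controls compact sets only, hence
  the passage to the closure of \<open>B\<close>.\<close>

lemma M_class_set_integrable:
  assumes "bump_function \<phi>" and \<mu>: "(\<nu>, h) \<in> M_class p \<phi>"
    and k [measurable]: "k \<in> borel_measurable borel" "\<And>x. \<bar>k x\<bar> \<le> 1"
    and B [measurable]: "B \<in> sets borel" and "bounded B"
  shows "set_integrable \<nu> B (\<lambda>x. \<phi> x * k x)"
proof -
  note [measurable_cong] = M_classD(1)[OF \<mu>]
  note [measurable] = bump_function_measurable[OF assms(1)]
  have "(\<integral>\<^sup>+x. ennreal (norm (indicator B x *\<^sub>R (\<phi> x * k x))) \<partial>\<nu>) \<le> (\<integral>\<^sup>+x\<in>closure B. ennreal (\<phi> x) \<partial>\<nu>)"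
  proof (rule nn_integral_mono)
    fix x
    have "\<phi> x * \<bar>k x\<bar> \<le> \<phi> x * 1"
      using k bump_function_pos[OF assms(1), of x] by (intro mult_left_mono) auto
    then show "ennreal (norm (indicator B x *\<^sub>R (\<phi> x * k x))) \<le> ennreal (\<phi> x) * indicator (closure B) x"
      using closure_subset[of B] bump_function_pos[OF assms(1), of x]
      by (auto simp: indicator_def abs_mult intro!: ennreal_leI)
  qed
  also have "\<dots> < \<infinity>"
    using M_classD(5)[OF \<mu>] \<open>bounded B\<close> by (simp add: compact_closure)
  finally show ?thesis
    unfolding set_integrable_def by (intro integrableI_bounded) auto
qed

lemma g_mu_eq: "g_mu \<phi> (\<nu>, h) x = (LINT t:anchored_interval x|\<nu>. \<phi> t * h t)"
  by (auto simp: g_mu_def signed_integral_def anchored_interval_def)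

text \<open>The indicators of the two anchored intervals differ only on the segment, by at most 1,
  and \<open>h\<close> has modulus 1. When 0 separates \<open>x\<close> and \<open>y\<close> the two
  integrals enter with opposite signs, so the increment is not the integral over the segment, but
  the bound in modulus persists.\<close>

lemma g_mu_increment_le:
  assumes "bump_function \<phi>" and \<mu>: "(\<nu>, h) \<in> M_class p \<phi>"
  shows "ennreal \<bar>g_mu \<phi> (\<nu>, h) x - g_mu \<phi> (\<nu>, h) y\<bar>
    \<le> (\<integral>\<^sup>+t. ennreal (\<phi> t * indicator (closed_segment x y) t) \<partial>\<nu>)"
proof -
  let ?f = "\<lambda>x t. indicator (anchored_interval x) t *\<^sub>R (\<phi> t * h t)"
  have h: "\<bar>h t\<bar> = 1" for t using M_classD(4)[OF \<mu>, of t] by auto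
  have i: "integrable \<nu> (?f z)" for z
    using M_class_set_integrable[OF assms M_classD(3)[OF \<mu>], of "anchored_interval z"]
      bounded_subset[OF bounded_closed_interval anchored_interval_bounded] h
    by (simp add: set_integrable_def)
  have "ennreal \<bar>g_mu \<phi> (\<nu>, h) x - g_mu \<phi> (\<nu>, h) y\<bar> = ennreal (norm (\<integral>t. ?f x t - ?f y t \<partial>\<nu>))"
    by (subst Bochner_Integration.integral_diff[OF i i]) (simp add: g_mu_eq set_lebesgue_integral_def)
  also have "\<dots> \<le> (\<integral>\<^sup>+t. ennreal (norm (?f x t - ?f y t)) \<partial>\<nu>)"
    by (intro integral_norm_bound_ennreal Bochner_Integration.integrable_diff i)
  also have "\<dots> \<le> (\<integral>\<^sup>+t. ennreal (\<phi> t * indicator (closed_segment x y) t) \<partial>\<nu>)"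
    using bump_function_pos[OF assms(1)] h
    by (intro nn_integral_mono ennreal_leI)
       (auto simp: indicator_def anchored_interval_def closed_segment_eq_real_ivl abs_mult less_imp_le)
  finally show ?thesis .
qed

text \<open>Points \<open>t \<le> x\<close> belong to the anchored interval at
  \<open>S n > x\<close> exactly if they belong to the one at \<open>x\<close>; points
  \<open>t > x\<close> do so once \<open>S n < t\<close>. Dominated convergence then applies.
  Approach from the left could change the integral by the mass at \<open>x\<close>.\<close>

lemma g_mu_right_continuous:
  assumes "bump_function \<phi>" and \<mu>: "(\<nu>, h) \<in> M_class p \<phi>"
  shows "(g_mu \<phi> (\<nu>, h) \<longlongrightarrow> g_mu \<phi> (\<nu>, h) x) (at_right x)"
proof (rule tendsto_at_right_sequentially[of x "x + 1"])
  note [measurable_cong] = M_classD(1)[OF \<mu>]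
  note [measurable] = bump_function_measurable[OF assms(1)] M_classD(3)[OF \<mu>]
  fix S :: "nat \<Rightarrow> real"
  assume S: "\<And>n. x < S n" "\<And>n. S n < x + 1" "S \<longlonglongrightarrow> x"
  have h: "\<bar>h t\<bar> = 1" for t using M_classD(4)[OF \<mu>, of t] by auto
  \<comment> \<open>The restriction \<open>S n < x + 1\<close> keeps all intervals in this compact
    window, on which \<open>\<phi>\<close> is integrable.\<close>
  let ?K = "{- \<bar>x\<bar> - 1..\<bar>x\<bar> + 1}"
  show "(\<lambda>n. g_mu \<phi> (\<nu>, h) (S n)) \<longlonglongrightarrow> g_mu \<phi> (\<nu>, h) x"
    unfolding g_mu_eq set_lebesgue_integral_def
  proof (rule integral_dominated_convergence)
    show "integrable \<nu> (\<lambda>t. indicator ?K t *\<^sub>R (\<phi> t * 1))"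
      using M_class_set_integrable[OF assms, of "\<lambda>_. 1" ?K] by (simp add: set_integrable_def)
    show "AE t in \<nu>. (\<lambda>n. indicator (anchored_interval (S n)) t *\<^sub>R (\<phi> t * h t))
        \<longlonglongrightarrow> indicator (anchored_interval x) t *\<^sub>R (\<phi> t * h t)"
    proof (rule AE_I2, rule tendsto_eventually)
      fix t
      have "\<forall>\<^sub>F n in sequentially. x < t \<longrightarrow> S n < t"
        using order_tendstoD(2)[OF S(3), of t] by (cases "x < t") auto
      then show "\<forall>\<^sub>F n in sequentially. indicator (anchored_interval (S n)) t *\<^sub>R (\<phi> t * h t) =
          indicator (anchored_interval x) t *\<^sub>R (\<phi> t * h t)"
      proof eventually_elim
        case (elim n)
        then have "t \<in> anchored_interval (S n) \<longleftrightarrow> t \<in> anchored_interval x"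
          using S(1)[of n] by (auto simp: anchored_interval_def)
        then show ?case by (simp add: indicator_def)
      qed
    qed
    show "AE t in \<nu>. norm (indicator (anchored_interval (S n)) t *\<^sub>R (\<phi> t * h t))
        \<le> indicator ?K t *\<^sub>R (\<phi> t * 1)" for n
    proof (rule AE_I2)
      fix t
      have "t \<in> anchored_interval (S n) \<Longrightarrow> t \<in> ?K"
        using S(1,2)[of n] by (auto simp: anchored_interval_def)
      then show "norm (indicator (anchored_interval (S n)) t *\<^sub>R (\<phi> t * h t))
          \<le> indicator ?K t *\<^sub>R (\<phi> t * 1)"
        using bump_function_pos[OF assms(1), of t] h[of t] by (simp add: indicator_def abs_mult)
    qed
  qed measurable
qed simp

section \<open>The atomic part \<open>Delta_fun\<close>\<close>

lemma Delta_fun_eq: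
  assumes "inj a"
  shows "Delta_fun \<phi> a l (a i) = l i * \<phi> (a i)"
    and "x \<notin> range a \<Longrightarrow> Delta_fun \<phi> a l x = 0"
proof -
  have "(\<lambda>j. l j * \<phi> (a j) * indicator {a j} (a i)) sums (l i * \<phi> (a i))"
  proof -
    have "(\<lambda>j. l j * \<phi> (a j) * indicator {a j} (a i)) = (\<lambda>j. if j = i then l j * \<phi> (a j) else 0)"
      using assms by (auto simp: fun_eq_iff indicator_def inj_eq)
    then show ?thesis using sums_single[of i "\<lambda>j. l j * \<phi> (a j)"] by simp
  qed
  then show "Delta_fun \<phi> a l (a i) = l i * \<phi> (a i)"
    unfolding Delta_fun_def by (rule sums_unique[symmetric])
  assume "x \<notin> range a"
  then have "(\<lambda>j. l j * \<phi> (a j) * indicator {a j} x) = (\<lambda>j. 0)"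
    by (auto simp: indicator_def fun_eq_iff)
  then show "Delta_fun \<phi> a l x = 0" by (simp add: Delta_fun_def)
qed

lemma Delta_fun_le:
  assumes "inj a" and \<phi>: "\<And>x. 0 < \<phi> x"
  shows "ennreal \<bar>Delta_fun \<phi> a l x\<bar>
    \<le> (\<integral>\<^sup>+i. ennreal (\<bar>l i\<bar> * \<phi> (a i) * indicator {x} (a i)) \<partial>count_space UNIV)"
proof (cases "x \<in> range a")
  case True
  then obtain i where i: "x = a i" by blast
  have "ennreal \<bar>Delta_fun \<phi> a l x\<bar> = ennreal (\<bar>l i\<bar> * \<phi> (a i) * indicator {x} (a i))"
    using Delta_fun_eq(1)[OF assms(1)] \<phi>[of "a i"] by (simp add: i abs_mult)
  also have "\<dots> \<le> (\<integral>\<^sup>+i. ennreal (\<bar>l i\<bar> * \<phi> (a i) * indicator {x} (a i)) \<partial>count_space UNIV)"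
    by (rule nn_integral_ge_point) simp
  finally show ?thesis .
qed (simp add: Delta_fun_eq(2)[OF assms(1)])

text \<open>Both end points lie in the segment, and for \<open>x \<noteq> y\<close> no index is
  counted twice. The counting measure gives the bound the same shape as
  \<open>g_mu_increment_le\<close>.\<close>

lemma Delta_fun_increment_le:
  assumes "inj a" and \<phi>: "\<And>x. 0 < \<phi> x"
  shows "ennreal \<bar>Delta_fun \<phi> a l x - Delta_fun \<phi> a l y\<bar>
    \<le> (\<integral>\<^sup>+i. ennreal (\<bar>l i\<bar> * \<phi> (a i) * indicator (closed_segment x y) (a i)) \<partial>count_space UNIV)"
proof (cases "x = y")
  case False
  let ?w = "\<lambda>i. \<bar>l i\<bar> * \<phi> (a i)"
  have w: "0 \<le> ?w i" for i using \<phi>[of "a i"] by simp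
  have "ennreal \<bar>Delta_fun \<phi> a l x - Delta_fun \<phi> a l y\<bar>
      \<le> ennreal \<bar>Delta_fun \<phi> a l x\<bar> + ennreal \<bar>Delta_fun \<phi> a l y\<bar>"
    by (simp add: ennreal_plus[symmetric] del: ennreal_plus)
  also have "\<dots> \<le> (\<integral>\<^sup>+i. ennreal (?w i * indicator {x} (a i)) \<partial>count_space UNIV)
      + (\<integral>\<^sup>+i. ennreal (?w i * indicator {y} (a i)) \<partial>count_space UNIV)"
    by (intro add_mono Delta_fun_le assms)
  also have "\<dots> = (\<integral>\<^sup>+i. ennreal (?w i * indicator {x} (a i)) + ennreal (?w i * indicator {y} (a i))
      \<partial>count_space UNIV)"
    by (simp add: nn_integral_add)
  also have "\<dots> \<le> (\<integral>\<^sup>+i. ennreal (?w i * indicator (closed_segment x y) (a i)) \<partial>count_space UNIV)"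
    using False w by (intro nn_integral_mono) (auto simp: indicator_def closed_segment_eq_real_ivl)
  finally show ?thesis .
qed simp

section \<open>Uniqueness of the decomposition and of the variation\<close>

text \<open>The right-continuous parts \<open>c + g_mu\<close> of the two decompositions differ only
  on a countable set. A difference at one point would persist on an open interval to its right,
  which is uncountable. Evaluation at 0, where \<open>g_mu\<close> vanishes, then separates the
  constants.\<close>

lemma decomposes_g_mu_Delta_unique:
  assumes b: "bump_function \<phi>"
    and d1: "decomposes p \<phi> g c1 (\<nu>1, h1) a1 l1" and d2: "decomposes p \<phi> g c2 (\<nu>2, h2) a2 l2"
  shows "g_mu \<phi> (\<nu>1, h1) = g_mu \<phi> (\<nu>2, h2)" and "Delta_fun \<phi> a1 l1 = Delta_fun \<phi> a2 l2"
proof -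
  let ?G1 = "g_mu \<phi> (\<nu>1, h1)" and ?G2 = "g_mu \<phi> (\<nu>2, h2)"
  let ?D1 = "Delta_fun \<phi> a1 l1" and ?D2 = "Delta_fun \<phi> a2 l2"
  have \<mu>: "(\<nu>1, h1) \<in> M_class p \<phi>" "(\<nu>2, h2) \<in> M_class p \<phi>" and inj: "inj a1" "inj a2"
    and g1: "g = (\<lambda>x. c1 + ?G1 x + ?D1 x)" and g2: "g = (\<lambda>x. c2 + ?G2 x + ?D2 x)"
    using d1 d2 unfolding decomposes_def Delta_params_def by blast+
  have eq: "c1 + ?G1 x + ?D1 x = c2 + ?G2 x + ?D2 x" for x using g1 g2 by metis
  let ?h = "\<lambda>x. (c1 + ?G1 x) - (c2 + ?G2 x)"
  have h0: "?h x = 0" for x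
  proof (rule ccontr)
    assume "?h x \<noteq> 0"
    moreover have "(?h \<longlongrightarrow> ?h x) (at_right x)"
      by (intro tendsto_intros g_mu_right_continuous[OF b \<mu>(1)] g_mu_right_continuous[OF b \<mu>(2)])
    ultimately have "\<forall>\<^sub>F y in at_right x. ?h y \<noteq> 0"
      using tendsto_imp_eventually_ne by blast
    then obtain z where z: "z > x" "\<And>y. x < y \<Longrightarrow> y < z \<Longrightarrow> ?h y \<noteq> 0"
      by (auto simp: eventually_at_right_field)
    have "{x<..<z} \<subseteq> range a1 \<union> range a2"
    proof
      fix y assume "y \<in> {x<..<z}"
      then have "?D1 y \<noteq> ?D2 y" using z(2)[of y] eq[of y] by auto
      then show "y \<in> range a1 \<union> range a2"
        by (metis UnCI Delta_fun_eq(2)[OF inj(1)] Delta_fun_eq(2)[OF inj(2)])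
    qed
    then have "countable {x<..<z}" by (rule countable_subset) auto
    then show False using uncountable_open_interval[of x z] z(1) by simp
  qed
  have "?G1 0 = 0" "?G2 0 = 0" by (simp_all add: g_mu_eq set_lebesgue_integral_def)
  then have "c1 = c2" using h0[of 0] by simp
  then have G: "?G1 x = ?G2 x" for x using h0[of x] by simp
  then show "?G1 = ?G2" by (rule ext)
  show "?D1 = ?D2" using eq G \<open>c1 = c2\<close> by (intro ext) simp
qed

text \<open>An inequality suffices: the hypotheses are symmetric, so exchanging the two measures
  gives equality, without any comparison of \<open>h1\<close> with \<open>h2\<close>.\<close>

lemma g_mu_eq_imp_tv_le:
  assumes b: "bump_function \<phi>"
    and \<mu>1: "(\<nu>1, h1) \<in> M_class p \<phi>" and \<mu>2: "(\<nu>2, h2) \<in> M_class p \<phi>"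
    and G: "g_mu \<phi> (\<nu>1, h1) = g_mu \<phi> (\<nu>2, h2)"
  shows "(LINT t:anchored_interval x|\<nu>1. \<phi> t) \<le> (LINT t:anchored_interval x|\<nu>2. \<phi> t)"
proof -
  let ?J = "anchored_interval x"
  note [measurable] = M_classD(3)[OF \<mu>1] M_classD(3)[OF \<mu>2]
  have bd: "bounded (A \<inter> anchored_interval x)" for A x
    using bounded_subset[OF bounded_closed_interval anchored_interval_bounded] by blast
  note bd' = bd[of UNIV, simplified]
  have h: "\<bar>h1 t\<bar> = 1" "\<bar>h2 t\<bar> = 1" for t
    using M_classD(4)[OF \<mu>1, of t] M_classD(4)[OF \<mu>2, of t] by auto
  have I1: "set_integrable \<nu>1 A (\<lambda>t. \<phi> t * h1 t)" "set_integrable \<nu>1 A \<phi>"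
    if "bounded A" "A \<in> sets borel" for A
    using M_class_set_integrable[OF b \<mu>1, of h1 A] M_class_set_integrable[OF b \<mu>1, of "\<lambda>_. 1" A] that h
    by auto
  have I2: "set_integrable \<nu>2 A (\<lambda>t. \<phi> t * h2 t)" "set_integrable \<nu>2 A \<phi>"
    if "bounded A" "A \<in> sets borel" for A
    using M_class_set_integrable[OF b \<mu>2, of h2 A] M_class_set_integrable[OF b \<mu>2, of "\<lambda>_. 1" A] that h
    by auto
  have eq: "(LINT t:B \<inter> ?J|\<nu>1. \<phi> t * h1 t) = (LINT t:B \<inter> ?J|\<nu>2. \<phi> t * h2 t)"
    if "B \<in> sets borel" for B
    using G that M_classD(1)[OF \<mu>1] M_classD(1)[OF \<mu>2]
    by (intro set_integral_eq_of_anchored_interval)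
       (auto intro!: I1 I2 bd' simp: g_mu_eq fun_eq_iff)
  have ab: "\<bar>LINT t:B \<inter> ?J|\<nu>2. \<phi> t * h2 t\<bar> \<le> (LINT t:B \<inter> ?J|\<nu>2. \<phi> t)" if "B \<in> sets borel" for B
  proof -
    have "norm (LINT t:B \<inter> ?J|\<nu>2. \<phi> t * h2 t) \<le> (LINT t:B \<inter> ?J|\<nu>2. norm (\<phi> t * h2 t))"
      using I2(1)[OF bd[of B x]] that by (intro set_integral_norm_bound) auto
    also have "\<dots> = (LINT t:B \<inter> ?J|\<nu>2. \<phi> t)"
      using h bump_function_pos[OF b] by (simp add: abs_mult less_imp_le)
    finally show ?thesis by simp
  qed
  \<comment> \<open>On each of the two sign sets of \<open>h1\<close> the measure \<open>\<nu>1\<close> is a signed integral, which transfers to \<open>\<nu>2\<close>.\<close>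
  define P where "P = {t. h1 t = 1}"
  define N where "N = {t. h1 t = -1}"
  have PN [measurable]: "P \<in> sets borel" "N \<in> sets borel" by (simp_all add: P_def N_def)
  have J: "?J = (P \<inter> ?J) \<union> (N \<inter> ?J)"
    using M_classD(4)[OF \<mu>1] by (auto simp: P_def N_def)
  have dj: "(P \<inter> ?J) \<inter> (N \<inter> ?J) = {}" by (auto simp: P_def N_def)
  have "(LINT t:?J|\<nu>1. \<phi> t) = (LINT t:P \<inter> ?J|\<nu>1. \<phi> t) + (LINT t:N \<inter> ?J|\<nu>1. \<phi> t)"
    by (subst J, rule set_integral_Un[OF dj]) (auto intro!: I1 bd)
  also have "(LINT t:P \<inter> ?J|\<nu>1. \<phi> t) = (LINT t:P \<inter> ?J|\<nu>1. \<phi> t * h1 t)"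
    by (rule set_lebesgue_integral_cong) (auto simp: P_def M_classD(1)[OF \<mu>1])
  also have "(LINT t:N \<inter> ?J|\<nu>1. \<phi> t) = (LINT t:N \<inter> ?J|\<nu>1. - (\<phi> t * h1 t))"
    by (rule set_lebesgue_integral_cong) (auto simp: N_def M_classD(1)[OF \<mu>1])
  also have "\<dots> = - (LINT t:N \<inter> ?J|\<nu>1. \<phi> t * h1 t)"
    by (rule set_integral_uminus) (auto intro!: I1 bd)
  also have "(LINT t:P \<inter> ?J|\<nu>1. \<phi> t * h1 t) + - (LINT t:N \<inter> ?J|\<nu>1. \<phi> t * h1 t)
      \<le> (LINT t:P \<inter> ?J|\<nu>2. \<phi> t) + (LINT t:N \<inter> ?J|\<nu>2. \<phi> t)"
    using ab[OF PN(1)] ab[OF PN(2)] eq[OF PN(1)] eq[OF PN(2)] by linarith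
  also have "\<dots> = (LINT t:?J|\<nu>2. \<phi> t)"
    by (subst (3) J, rule set_integral_Un[OF dj, symmetric]) (auto intro!: I2 bd)
  finally show ?thesis .
qed

text \<open>The anchored intervals form an intersection-stable generator, and countably many of
  them, of finite weighted mass, cover the line. Equality of the weighted measures suffices for the
  variation because \<open>\<phi> powr (1 + 1 / p)\<close> is \<open>\<phi>\<close> times
  \<open>\<phi> powr (1 / p)\<close>.\<close>

lemma g_mu_eq_imp_density_eq:
  assumes b: "bump_function \<phi>"
    and \<mu>1: "(\<nu>1, h1) \<in> M_class p \<phi>" and \<mu>2: "(\<nu>2, h2) \<in> M_class p \<phi>"
    and G: "g_mu \<phi> (\<nu>1, h1) = g_mu \<phi> (\<nu>2, h2)"
  shows "density \<nu>1 (\<lambda>t. ennreal (\<phi> t)) = density \<nu>2 (\<lambda>t. ennreal (\<phi> t))"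
proof -
  note [measurable] = bump_function_measurable[OF b]
  have em: "emeasure (density \<nu> (\<lambda>t. ennreal (\<phi> t))) (anchored_interval x)
      = ennreal (LINT t:anchored_interval x|\<nu>. \<phi> t)"
    if \<mu>: "(\<nu>, h) \<in> M_class p \<phi>" for \<nu> h x
  proof -
    note [measurable_cong] = M_classD(1)[OF \<mu>]
    have "bounded (anchored_interval x)"
      using bounded_subset[OF bounded_closed_interval anchored_interval_bounded] .
    then have i: "integrable \<nu> (\<lambda>t. indicator (anchored_interval x) t *\<^sub>R \<phi> t)"
      using M_class_set_integrable[OF b \<mu>, of "\<lambda>_. 1" "anchored_interval x"]
      by (simp add: set_integrable_def)
    have "emeasure (density \<nu> (\<lambda>t. ennreal (\<phi> t))) (anchored_interval x)
        = (\<integral>\<^sup>+t. ennreal (indicator (anchored_interval x) t *\<^sub>R \<phi> t) \<partial>\<nu>)"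
      by (subst emeasure_density) (auto intro!: nn_integral_cong simp: indicator_def)
    also have "\<dots> = ennreal (LINT t:anchored_interval x|\<nu>. \<phi> t)"
      unfolding set_lebesgue_integral_def using i bump_function_pos[OF b]
      by (intro nn_integral_eq_integral) (auto simp: less_imp_le)
    finally show ?thesis .
  qed
  show ?thesis
  proof (rule measure_eqI_generator_eq_countable[OF Int_stable_anchored_interval])
    show "emeasure (density \<nu>1 (\<lambda>t. ennreal (\<phi> t))) X = emeasure (density \<nu>2 (\<lambda>t. ennreal (\<phi> t))) X"
      if *: "X \<in> range anchored_interval" for X
    proof -
      obtain x where X: "X = anchored_interval x" using * by blast
      have "(LINT t:X|\<nu>1. \<phi> t) = (LINT t:X|\<nu>2. \<phi> t)"
        unfolding X by (intro order.antisym g_mu_eq_imp_tv_le[OF b \<mu>1 \<mu>2 G]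
          g_mu_eq_imp_tv_le[OF b \<mu>2 \<mu>1 G[symmetric]])
      then show ?thesis unfolding X em[OF \<mu>1] em[OF \<mu>2] by simp
    qed
    show "range (\<lambda>n::int. anchored_interval (of_int n)) \<subseteq> range anchored_interval" by auto
    show "\<Union> (range (\<lambda>n::int. anchored_interval (of_int n))) = UNIV" by (rule UN_anchored_interval)
    show "emeasure (density \<nu>1 (\<lambda>t. ennreal (\<phi> t))) X \<noteq> \<infinity>"
      if "X \<in> range (\<lambda>n::int. anchored_interval (of_int n))" for X
      using that em[OF \<mu>1] by auto
  qed (auto simp: M_classD(1)[OF \<mu>1] M_classD(1)[OF \<mu>2] borel_eq_sigma_anchored_interval)
qed

lemma g_mu_eq_imp_variation_eq:
  assumes b: "bump_function \<phi>"
    and \<mu>1: "(\<nu>1, h1) \<in> M_class p \<phi>" and \<mu>2: "(\<nu>2, h2) \<in> M_class p \<phi>"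
    and G: "g_mu \<phi> (\<nu>1, h1) = g_mu \<phi> (\<nu>2, h2)"
  shows "(LINT t|\<nu>1. \<phi> t powr (1 + 1 / p)) = (LINT t|\<nu>2. \<phi> t powr (1 + 1 / p))"
proof -
  note [measurable] = bump_function_measurable[OF b]
  have "(LINT t|\<nu>. \<phi> t powr (1 + 1 / p))
      = enn2real (\<integral>\<^sup>+t. ennreal (\<phi> t powr (1 / p)) \<partial>density \<nu> (\<lambda>t. ennreal (\<phi> t)))"
    if \<mu>: "(\<nu>, h) \<in> M_class p \<phi>" for \<nu> h
  proof -
    note [measurable_cong] = M_classD(1)[OF \<mu>]
    have "(LINT t|\<nu>. \<phi> t powr (1 + 1 / p)) = enn2real (\<integral>\<^sup>+t. ennreal (\<phi> t powr (1 + 1 / p)) \<partial>\<nu>)"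
      by (intro integral_eq_nn_integral) auto
    also have "(\<integral>\<^sup>+t. ennreal (\<phi> t powr (1 + 1 / p)) \<partial>\<nu>)
        = (\<integral>\<^sup>+t. ennreal (\<phi> t) * ennreal (\<phi> t powr (1 / p)) \<partial>\<nu>)"
      using bump_function_pos[OF b]
      by (intro nn_integral_cong) (simp add: ennreal_mult[symmetric] powr_add less_imp_le)
    also have "\<dots> = (\<integral>\<^sup>+t. ennreal (\<phi> t powr (1 / p)) \<partial>density \<nu> (\<lambda>t. ennreal (\<phi> t)))"
      by (rule nn_integral_density[symmetric]) measurable
    finally show ?thesis .
  qed
  from this[OF \<mu>1] this[OF \<mu>2] g_mu_eq_imp_density_eq[OF assms] show ?thesis by simp
qed

text \<open>Summing over points instead of indices shows that the value depends only on the
  function, not on its enumeration or on atoms of weight 0.\<close>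

lemma Delta_variation_eq_infsum:
  assumes "bump_function \<phi>" and "(a, l) \<in> Delta_params p \<phi>"
  shows "(\<Sum>i. \<bar>l i\<bar> * \<phi> (a i) powr (1 + 1 / p))
    = infsum (\<lambda>x. \<bar>Delta_fun \<phi> a l x\<bar> * \<phi> x powr (1 / p)) UNIV"
proof -
  have inj: "inj a" and sm: "summable (\<lambda>i. \<bar>l i\<bar> * \<phi> (a i) powr (1 + 1 / p))"
    using assms(2) by (auto simp: Delta_params_def)
  have "((\<lambda>i. \<bar>l i\<bar> * \<phi> (a i) powr (1 + 1 / p)) has_sum (\<Sum>i. \<bar>l i\<bar> * \<phi> (a i) powr (1 + 1 / p))) UNIV"
    using sm by (intro sums_nonneg_imp_has_sum summable_sums) auto
  then have "(\<Sum>i. \<bar>l i\<bar> * \<phi> (a i) powr (1 + 1 / p))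
      = infsum (\<lambda>i. \<bar>l i\<bar> * \<phi> (a i) powr (1 + 1 / p)) UNIV"
    by (rule infsumI[symmetric])
  also have "\<dots> = infsum ((\<lambda>x. \<bar>Delta_fun \<phi> a l x\<bar> * \<phi> x powr (1 / p)) \<circ> a) UNIV"
    using bump_function_pos[OF assms(1)]
    by (intro infsum_cong) (simp add: Delta_fun_eq(1)[OF inj] abs_mult powr_add less_imp_le)
  also have "\<dots> = infsum (\<lambda>x. \<bar>Delta_fun \<phi> a l x\<bar> * \<phi> x powr (1 / p)) (range a)"
    by (rule infsum_reindex[symmetric]) (rule inj)
  also have "\<dots> = infsum (\<lambda>x. \<bar>Delta_fun \<phi> a l x\<bar> * \<phi> x powr (1 / p)) UNIV"
    by (rule infsum_cong_neutral) (auto simp: Delta_fun_eq(2)[OF inj])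
  finally show ?thesis .
qed

lemma V_var_eq:
  assumes b: "bump_function \<phi>" and d: "decomposes p \<phi> g c (\<nu>, h) a l"
  shows "V_var p \<phi> g = (LINT x|\<nu>. \<phi> x powr (1 + 1 / p)) + (\<Sum>i. \<bar>l i\<bar> * \<phi> (a i) powr (1 + 1 / p))"
  unfolding V_var_def
proof (rule the_equality)
  show "\<exists>c \<mu> a' l'. decomposes p \<phi> g c \<mu> a' l' \<and>
      (LINT x|\<nu>. \<phi> x powr (1 + 1 / p)) + (\<Sum>i. \<bar>l i\<bar> * \<phi> (a i) powr (1 + 1 / p)) =
      (LINT x|tv \<mu>. \<phi> x powr (1 + 1 / p)) + (\<Sum>i. \<bar>l' i\<bar> * \<phi> (a' i) powr (1 + 1 / p))"
    using d by fastforce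
next
  fix v
  assume "\<exists>c \<mu> a l. decomposes p \<phi> g c \<mu> a l \<and>
      v = (LINT x|tv \<mu>. \<phi> x powr (1 + 1 / p)) + (\<Sum>i. \<bar>l i\<bar> * \<phi> (a i) powr (1 + 1 / p))"
  then obtain c' \<nu>' h' a' l' where d': "decomposes p \<phi> g c' (\<nu>', h') a' l'"
    and v: "v = (LINT x|\<nu>'. \<phi> x powr (1 + 1 / p)) + (\<Sum>i. \<bar>l' i\<bar> * \<phi> (a' i) powr (1 + 1 / p))"
    by auto
  note u = decomposes_g_mu_Delta_unique[OF b d' d]
  have "(LINT x|\<nu>'. \<phi> x powr (1 + 1 / p)) = (LINT x|\<nu>. \<phi> x powr (1 + 1 / p))"
    using d d' u(1) by (intro g_mu_eq_imp_variation_eq[OF b]) (auto simp: decomposes_def)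
  moreover have "(\<Sum>i. \<bar>l' i\<bar> * \<phi> (a' i) powr (1 + 1 / p)) = (\<Sum>i. \<bar>l i\<bar> * \<phi> (a i) powr (1 + 1 / p))"
    using d d' u(2) by (simp add: Delta_variation_eq_infsum[OF b] decomposes_def)
  ultimately show "v = (LINT x|\<nu>. \<phi> x powr (1 + 1 / p)) + (\<Sum>i. \<bar>l i\<bar> * \<phi> (a i) powr (1 + 1 / p))"
    using v by simp
qed

section \<open>Moment bound for the increments of \<open>g\<close>\<close>

lemma g_mu_measurable:
  assumes "bump_function \<phi>" and \<mu>: "(\<nu>, h) \<in> M_class p \<phi>"
  shows "g_mu \<phi> (\<nu>, h) \<in> borel_measurable borel"
proof -
  interpret sigma_finite_measure \<nu> using M_classD(2)[OF \<mu>] .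
  note [measurable_cong] = M_classD(1)[OF \<mu>]
  note [measurable] = bump_function_measurable[OF assms(1)] M_classD(3)[OF \<mu>]
  \<comment> \<open>Written with order conditions, the integrand is visibly measurable jointly in
    \<open>x\<close> and \<open>t\<close>.\<close>
  have "(\<lambda>x. \<integral>t. of_bool (0 < t \<and> t \<le> x \<or> x < t \<and> t \<le> 0) * (\<phi> t * h t) \<partial>\<nu>) \<in> borel_measurable borel"
    by (rule borel_measurable_lebesgue_integral) measurable
  then show ?thesis
    by (rule measurable_cong[THEN iffD1, rotated])
       (auto simp: g_mu_eq set_lebesgue_integral_def indicator_def anchored_interval_def)
qed

lemma Delta_fun_measurable: "Delta_fun \<phi> a l \<in> borel_measurable borel"
  unfolding Delta_fun_def[abs_def] by measurable

lemma powr_add_le: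
  fixes x y p :: real
  assumes "0 \<le> x" "0 \<le> y" "0 \<le> p"
  shows "(x + y) powr p \<le> 2 powr p * (x powr p + y powr p)"
proof -
  have "(x + y) powr p \<le> (2 * max x y) powr p" using assms by (intro powr_mono2) auto
  also have "\<dots> = 2 powr p * max x y powr p" using assms by (simp add: powr_mult)
  also have "\<dots> \<le> 2 powr p * (x powr p + y powr p)" by (intro mult_left_mono) (auto simp: max_def)
  finally show ?thesis .
qed

text \<open>This recombines the bounds for the two parts of \<open>g\<close> into a power of the
  total variation at no cost, so that the splitting contributes only the factor
  \<open>2 powr p\<close>.\<close>

lemma powr_superadditive:
  fixes x y p :: real
  assumes "0 \<le> x" "0 \<le> y" "1 \<le> p"
  shows "x powr p + y powr p \<le> (x + y) powr p"
proof -
  have mult: "z powr p = z * z powr (p - 1)" if "0 \<le> z" for z :: real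
    using that by (cases "z = 0") (auto simp: powr_diff)
  have "x powr p + y powr p \<le> x * (x + y) powr (p - 1) + y * (x + y) powr (p - 1)"
    using assms by (auto simp: mult intro!: add_mono mult_left_mono powr_mono2)
  also have "\<dots> = (x + y) powr p" using assms by (simp add: mult[of "x + y"] algebra_simps)
  finally show ?thesis .
qed

text \<open>The constant \<open>C\<close> stays free because two values are needed later: the
  interpolated one when the norm of \<open>X - X'\<close> is finite, and 2 when it is
  infinite.\<close>

lemma decomposes_increment_le:
  assumes M: "prob_space M" and X [measurable]: "X \<in> borel_measurable M" "X' \<in> borel_measurable M"
    and b: "bump_function \<phi>" and p: "1 \<le> p" and d: "decomposes p \<phi> g c (\<nu>, h) a l"
    and C: "0 \<le> C"
    and P: "\<And>z. measure M {\<omega> \<in> space M. z \<in> closed_segment (X \<omega>) (X' \<omega>)} \<le> C * \<phi> z"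
  shows "(\<integral>\<^sup>+\<omega>. ennreal (\<bar>g (X \<omega>) - g (X' \<omega>)\<bar> powr p) \<partial>M) \<le> ennreal (2 powr p * (C * V_var p \<phi> g powr p))"
proof -
  interpret prob_space M by fact
  have \<mu>: "(\<nu>, h) \<in> M_class p \<phi>" and al: "(a, l) \<in> Delta_params p \<phi>"
    and g: "g = (\<lambda>x. c + g_mu \<phi> (\<nu>, h) x + Delta_fun \<phi> a l x)"
    using d by (simp_all add: decomposes_def)
  have inj: "inj a" and sm: "summable (\<lambda>i. \<bar>l i\<bar> * \<phi> (a i) powr (1 + 1 / p))"
    using al by (auto simp: Delta_params_def)
  note [measurable] = bump_function_measurable[OF b] g_mu_measurable[OF b \<mu>] Delta_fun_measurable
  note pos = bump_function_pos[OF b]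
  define V1 where "V1 = (LINT x|\<nu>. \<phi> x powr (1 + 1 / p))"
  define V2 where "V2 = (\<Sum>i. \<bar>l i\<bar> * \<phi> (a i) powr (1 + 1 / p))"
  have V: "V_var p \<phi> g = V1 + V2" using V_var_eq[OF b d] by (simp add: V1_def V2_def)
  have V0: "0 \<le> V1" "0 \<le> V2"
    by (auto simp: V1_def V2_def intro!: suminf_nonneg sm)
  have pw: "\<phi> x * \<phi> x powr (1 / p) = \<phi> x powr (1 + 1 / p)" for x
    using pos[of x] by (simp add: powr_add)
  have bt: "(\<integral>\<^sup>+\<omega>. ennreal (indicator (closed_segment (X \<omega>) (X' \<omega>)) z) \<partial>M) \<le> ennreal (C * \<phi> z)" for z
  proof -
    have "(\<integral>\<^sup>+\<omega>. ennreal (indicator (closed_segment (X \<omega>) (X' \<omega>)) z) \<partial>M)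
        = (\<integral>\<^sup>+\<omega>. indicator {\<omega> \<in> space M. z \<in> closed_segment (X \<omega>) (X' \<omega>)} \<omega> \<partial>M)"
      by (intro nn_integral_cong) (auto simp: indicator_def)
    also have "\<dots> = emeasure M {\<omega> \<in> space M. z \<in> closed_segment (X \<omega>) (X' \<omega>)}"
      by (rule nn_integral_indicator) (simp add: in_closed_segment_real_iff)
    finally show ?thesis using P[of z] by (simp add: emeasure_eq_measure ennreal_leI)
  qed
  let ?r1 = "\<lambda>\<omega>. \<bar>g_mu \<phi> (\<nu>, h) (X \<omega>) - g_mu \<phi> (\<nu>, h) (X' \<omega>)\<bar>"
  let ?r2 = "\<lambda>\<omega>. \<bar>Delta_fun \<phi> a l (X \<omega>) - Delta_fun \<phi> a l (X' \<omega>)\<bar>"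
  have 1: "(\<integral>\<^sup>+\<omega>. ennreal (?r1 \<omega> powr p) \<partial>M) \<le> ennreal (C * V1 powr p)"
  proof (rule nn_integral_powr_increment_le[where N = \<nu> and w = \<phi> and b = "\<lambda>t. t" and \<phi> = \<phi>])
    note [measurable_cong] = M_classD(1)[OF \<mu>]
    show "sigma_finite_measure \<nu>" by (rule M_classD(2)[OF \<mu>])
    have "(\<integral>\<^sup>+t. ennreal (\<phi> t powr (1 + 1 / p)) \<partial>\<nu>) = ennreal V1"
      unfolding V1_def using M_classD(6)[OF \<mu>]
      by (intro nn_integral_eq_integral integrableI_nonneg) auto
    then show "(\<integral>\<^sup>+t. ennreal (\<phi> t * \<phi> t powr (1 / p)) \<partial>\<nu>) = ennreal V1" by (simp add: pw)
    show "\<phi> \<in> borel_measurable \<nu>" "(\<lambda>t. t) \<in> borel_measurable \<nu>" by measurable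
    show "ennreal (?r1 \<omega>) \<le> (\<integral>\<^sup>+t. ennreal (\<phi> t * indicator (closed_segment (X \<omega>) (X' \<omega>)) t) \<partial>\<nu>)" for \<omega>
      by (rule g_mu_increment_le[OF b \<mu>])
  qed (use M p C V0 pos bt in \<open>auto simp: less_imp_le\<close>)
  have 2: "(\<integral>\<^sup>+\<omega>. ennreal (?r2 \<omega> powr p) \<partial>M) \<le> ennreal (C * V2 powr p)"
  proof (rule nn_integral_powr_increment_le[where N = "count_space UNIV"
        and w = "\<lambda>i. \<bar>l i\<bar> * \<phi> (a i)" and b = a and \<phi> = \<phi>])
    show "sigma_finite_measure (count_space (UNIV :: nat set))"
      by (rule sigma_finite_measure_count_space)
    have "(\<integral>\<^sup>+i. ennreal (\<bar>l i\<bar> * \<phi> (a i) powr (1 + 1 / p)) \<partial>count_space UNIV) = ennreal V2"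
      using sm by (simp add: nn_integral_count_space_nat V2_def suminf_ennreal2)
    then show "(\<integral>\<^sup>+i. ennreal (\<bar>l i\<bar> * \<phi> (a i) * \<phi> (a i) powr (1 / p)) \<partial>count_space UNIV) = ennreal V2"
      by (simp add: pw mult.assoc)
    show "ennreal (?r2 \<omega>) \<le>
        (\<integral>\<^sup>+i. ennreal (\<bar>l i\<bar> * \<phi> (a i) * indicator (closed_segment (X \<omega>) (X' \<omega>)) (a i)) \<partial>count_space UNIV)" for \<omega>
      by (rule Delta_fun_increment_le[OF inj pos])
  qed (use M p C V0 pos bt in \<open>auto simp: less_imp_le\<close>)
  have "(\<integral>\<^sup>+\<omega>. ennreal (\<bar>g (X \<omega>) - g (X' \<omega>)\<bar> powr p) \<partial>M)
      \<le> (\<integral>\<^sup>+\<omega>. ennreal (2 powr p) * (ennreal (?r1 \<omega> powr p) + ennreal (?r2 \<omega> powr p)) \<partial>M)"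
  proof (rule nn_integral_mono)
    fix \<omega>
    have "\<bar>g (X \<omega>) - g (X' \<omega>)\<bar> powr p \<le> (?r1 \<omega> + ?r2 \<omega>) powr p"
      using p by (intro powr_mono2) (auto simp: g)
    also have "\<dots> \<le> 2 powr p * (?r1 \<omega> powr p + ?r2 \<omega> powr p)"
      using p by (intro powr_add_le) auto
    finally have "ennreal (\<bar>g (X \<omega>) - g (X' \<omega>)\<bar> powr p)
        \<le> ennreal (2 powr p * (?r1 \<omega> powr p + ?r2 \<omega> powr p))" by (rule ennreal_leI)
    then show "ennreal (\<bar>g (X \<omega>) - g (X' \<omega>)\<bar> powr p)
        \<le> ennreal (2 powr p) * (ennreal (?r1 \<omega> powr p) + ennreal (?r2 \<omega> powr p))"
      by (simp add: ennreal_mult)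
  qed
  also have "\<dots> = ennreal (2 powr p) *
      ((\<integral>\<^sup>+\<omega>. ennreal (?r1 \<omega> powr p) \<partial>M) + (\<integral>\<^sup>+\<omega>. ennreal (?r2 \<omega> powr p) \<partial>M))"
    by (simp add: nn_integral_cmult nn_integral_add)
  also have "\<dots> \<le> ennreal (2 powr p) * (ennreal (C * V1 powr p) + ennreal (C * V2 powr p))"
    by (intro mult_left_mono add_mono 1 2) auto
  also have "\<dots> = ennreal (2 powr p * (C * (V1 powr p + V2 powr p)))"
    using C by (simp add: ennreal_mult distrib_left)
  also have "\<dots> \<le> ennreal (2 powr p * (C * (V1 + V2) powr p))"
    by (intro ennreal_leI mult_left_mono powr_superadditive C V0 p) auto
  finally show ?thesis by (simp add: V)
qed

theorem theorem5p7:
  fixes M :: "'w measure" and X X' :: "'w \<Rightarrow> real" and f \<phi> g :: "real \<Rightarrow> real"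
    and p q \<theta> :: real
  assumes "prob_space M"
    and "X \<in> borel_measurable M" and "X' \<in> borel_measurable M"
    and "distributed M lborel X (\<lambda>x. ennreal (f x))"
    and "\<And>x. 0 \<le> f x" and "bdd_above (range f)"
    and "0 < \<theta>" and "\<theta> < 1"
    and "tail_dominating M X X' \<theta> \<phi>"
    and "1 \<le> p"
    and "g \<in> G_class p \<phi>"
    and "1 \<le> q"
  shows "(\<integral>\<^sup>+\<omega>. ennreal (\<bar>g (X \<omega>) - g (X' \<omega>)\<bar> powr p) \<partial>M)
    \<le> ennreal (3 * 2 powr p * (SUP x. f x) powr (q * (1 - \<theta>) / (q + 1)) * (V_var p \<phi> g) powr p)
      * ennreal_powr (Lq_norm M q (\<lambda>\<omega>. X \<omega> - X' \<omega>)) (q * (1 - \<theta>) / (q + 1))"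
proof -
  interpret prob_space M by fact
  note X = assms(2,3) and \<theta> = assms(7,8) and p = assms(10) and q = assms(12)
  define s where "s = (SUP x. f x)"
  define V where "V = V_var p \<phi> g"
  define e where "e = q * (1 - \<theta>) / (q + 1)"
  have fs: "f x \<le> s" for x using assms(6) by (simp add: s_def cSUP_upper)
  have s: "0 < s" by (rule distributed_bound_pos[OF assms(1,4) fs])
  have b: "bump_function \<phi>" using assms(9) by (rule tail_dominating_imp_bump_function)
  obtain c \<nu> h a l where d: "decomposes p \<phi> g c (\<nu>, h) a l"
    using assms(11) unfolding G_class_def by fast
  note bound = decomposes_increment_le[OF assms(1) X b p d, folded V_def]
  let ?P = "\<lambda>z. measure M {\<omega> \<in> space M. z \<in> closed_segment (X \<omega>) (X' \<omega>)}"
  have "(\<integral>\<^sup>+\<omega>. ennreal (\<bar>g (X \<omega>) - g (X' \<omega>)\<bar> powr p) \<partial>M)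
    \<le> ennreal (3 * 2 powr p * s powr e * V powr p) * ennreal_powr (Lq_norm M q (\<lambda>\<omega>. X \<omega> - X' \<omega>)) e"
  proof (cases "\<integral>\<^sup>+\<omega>. ennreal (\<bar>X \<omega> - X' \<omega>\<bar> powr q) \<partial>M")
    case (real m)
    define S where "S = s powr (q / (q + 1)) * m powr (1 / (q + 1))"
    \<comment> \<open>The exponents match because \<open>e / q = (1 - \<theta>) / (q + 1)\<close>,
      the power of \<open>m\<close> in \<open>S powr (1 - \<theta>)\<close>.\<close>
    have norm: "ennreal_powr (Lq_norm M q (\<lambda>\<omega>. X \<omega> - X' \<omega>)) e = ennreal (m powr ((1 - \<theta>) / (q + 1)))"
      using real q by (simp add: Lq_norm_def ennreal_powr_def powr_powr e_def)
    have "?P z \<le> 3 * S powr (1 - \<theta>) * \<phi> z" for z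
    proof -
      obtain T where T: "0 \<le> T" "T powr \<theta> \<le> \<phi> z" "?P z \<le> 2 * T"
        using tail_dominating_closed_segment[OF assms(1) X assms(9) \<theta>(1)] by metis
      have "?P z \<le> 3 * S"
        unfolding S_def using real q by (intro prob_closed_segment_le[OF assms(1) X assms(4) fs]) auto
      with T \<theta> show ?thesis by (intro interpolate_le[of _ T S \<theta>]) (auto simp: S_def)
    qed
    from bound[OF _ this] have "(\<integral>\<^sup>+\<omega>. ennreal (\<bar>g (X \<omega>) - g (X' \<omega>)\<bar> powr p) \<partial>M)
        \<le> ennreal (2 powr p * (3 * S powr (1 - \<theta>) * V powr p))" by simp
    also have "S powr (1 - \<theta>) = s powr e * m powr ((1 - \<theta>) / (q + 1))"
      using s by (simp add: S_def powr_mult powr_powr e_def)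
    also have "2 powr p * (3 * (s powr e * m powr ((1 - \<theta>) / (q + 1))) * V powr p)
        = (3 * 2 powr p * s powr e * V powr p) * m powr ((1 - \<theta>) / (q + 1))"
      by (simp add: mult_ac)
    finally show ?thesis by (simp add: norm ennreal_mult)
  next
    case top
    then have norm: "ennreal_powr (Lq_norm M q (\<lambda>\<omega>. X \<omega> - X' \<omega>)) e = \<infinity>"
      by (simp add: Lq_norm_def ennreal_powr_def)
    show ?thesis
    \<comment> \<open>The right-hand side is infinite unless \<open>V = 0\<close>. Since
      \<open>0 * \<infinity> = 0\<close> in \<open>ennreal\<close>, the left-hand side must be shown
      to vanish for \<open>V = 0\<close>.\<close>
    proof (cases "V = 0")
      case True
      have "?P z \<le> 2 * \<phi> z" for z
      proof -
        obtain T where T: "0 \<le> T" "T \<le> 1" "T powr \<theta> \<le> \<phi> z" "?P z \<le> 2 * T"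
          using tail_dominating_closed_segment[OF assms(1) X assms(9) \<theta>(1)] by metis
        \<comment> \<open>Because \<open>T \<le> 1\<close>, lowering the exponent to
          \<open>\<theta>\<close> increases the power. Any finite constant in front of
          \<open>\<phi> z\<close> would do, as it is multiplied by
          \<open>V powr p = 0\<close>.\<close>
        have "T powr 1 \<le> T powr \<theta>" using T \<theta> by (intro powr_mono') auto
        then show ?thesis using T by simp
      qed
      from bound[OF _ this] show ?thesis using True by simp
    next
      case False
      then show ?thesis using s by (simp add: norm ennreal_mult_top)
    qed
  qed
  then show ?thesis by (simp only: s_def V_def e_def)
qed

end
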